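(* Let $d\ge2$, $\alpha\in(0,d)$, $\delta>0$ and $m\ge\omega_d\delta^d$. For all $Q\ge0$ both problems $$\min\left\{\mathcal F_{\alpha,Q}(E):\ |E|=m,\ E\in\mathcal K_\delta^{co}\right\}\qquad\text{and}\qquad\min\left\{\mathcal G_{\alpha,Q}(E):\ |E|=m,\ E\in\mathcal K_\delta^{co}\right\}$$ have a solution.
   Context: $|E|$ is Lebesgue measure in $\mathbb R^d$ and $\omega_d$ is the volume of the unit ball. $P(E)$ is the perimeter of $E$ in $\mathbb R^d$ in the sense of De Giorgi (equal to $\mathcal H^{d-1}(\partial E)$ when $E$ has smooth boundary). For a Borel set $A\subset\mathbb R^d$, $$\mathcal I_\alpha(A)=\inf\left\{\int_{\mathbb R^d\times\mathbb R^d}\frac{d\mu(x)\,d\mu(y)}{|x-y|^\alpha}:\ \mu \text{ non-negative Borel measure on }\mathbb R^d,\ \mu(A)=1\right\}\in[0,+\infty].$$ $\mathcal F_{\alpha,Q}(E)=P(E)+Q^2\mathcal I_\alpha(E)$ and $\mathcal G_{\alpha,Q}(E)=P(E)+Q^2\mathcal I_\alpha(\partial E)$, with values in $[0,+\infty]$. A set $E$ satisfies the $\delta$-ball condition if for every $x\in\partial E$ there are a ball of radius $\delta$ contained in $E$ and tangent to $\partial E$ at $x$ (an open ball $B_\delta(y)\subset E$ with $|x-y|=\delta$), and a ball of radius $\delta$ contained in $E^c=\mathbb R^d\setminus E$ and tangent to $\partial E$ at $x$ (an open ball $B_\delta(z)\subset E^c$ with $|x-z|=\delta$). $\mathcal K_\delta$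 is the class of all closed subsets of $\mathbb R^d$ satisfying the $\delta$-ball condition, and $\mathcal K_\delta^{co}$ is the subclass of connected sets in $\mathcal K_\delta$. *)

theory Defs
  imports "HOL-Analysis.Analysis"
begin

definition divergence :: "('a::euclidean_space \<Rightarrow> 'a) \<Rightarrow> 'a \<Rightarrow> real" where
  "divergence \<phi> x = (\<Sum>b\<in>Basis. frechet_derivative \<phi> (at x) b \<bullet> b)"

definition C1c_fields :: "('a::euclidean_space \<Rightarrow> 'a) set" where
  "C1c_fields = {\<phi>.
     (\<exists>D :: 'a \<Rightarrow> 'a \<Rightarrow>\<^sub>L 'a.
        (\<forall>x. (\<phi> has_derivative blinfun_apply (D x)) (at x)) \<and> continuous_on UNIV D) \<and>
     compact (closure {x. \<phi> x \<noteq> 0})}"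

text \<open>De Giorgi perimeter, for Lebesgue measurable \<open>E\<close>. The coercion \<^const>\<open>ennreal\<close> truncates
  negative values to 0; this does not change the supremum, as the zero field is admissible.\<close>

definition perimeter :: "'a::euclidean_space set \<Rightarrow> ennreal" where
  "perimeter E =
     (SUP \<phi> \<in> {\<phi> \<in> C1c_fields. \<forall>x. norm (\<phi> x) \<le> 1}.
        ennreal (LINT x:E|lebesgue. divergence \<phi> x))"

text \<open>On the diagonal the kernel \<open>1 / |x - y|\<^sup>\<alpha>\<close> is \<open>\<infinity>\<close>, since \<open>0 powr \<alpha> = 0\<close> and \<open>1 / 0 = \<infinity>\<close> in
  \<^typ>\<open>ennreal\<close>. The double integral is written as an iterated one, which for \<open>\<sigma>\<close>-finite \<open>\<mu>\<close> is the
  integral against \<open>\<mu> \<Otimes>\<^sub>M \<mu>\<close> (Tonelli). For measures that are not \<open>\<sigma>\<close>-finite the library's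
  product measure may degenerate to 0, whereas the iterated integral still dominates the energy
  of the restriction of \<open>\<mu>\<close> to \<open>A\<close>.\<close>

definition riesz_energy :: "real \<Rightarrow> 'a::euclidean_space measure \<Rightarrow> ennreal" where
  "riesz_energy \<alpha> \<mu> = (\<integral>\<^sup>+ x. (\<integral>\<^sup>+ y. 1 / ennreal (norm (x - y) powr \<alpha>) \<partial>\<mu>) \<partial>\<mu>)"

definition I_energy :: "real \<Rightarrow> 'a::euclidean_space set \<Rightarrow> ennreal" where
  "I_energy \<alpha> A = (INF \<mu> \<in> {\<mu>. sets \<mu> = sets borel \<and> emeasure \<mu> A = 1}. riesz_energy \<alpha> \<mu>)"

definition F_energy :: "real \<Rightarrow> real \<Rightarrow> 'a::euclidean_space set \<Rightarrow> ennreal" where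
  "F_energy \<alpha> Q E = perimeter E + ennreal (Q\<^sup>2) * I_energy \<alpha> E"

definition G_energy :: "real \<Rightarrow> real \<Rightarrow> 'a::euclidean_space set \<Rightarrow> ennreal" where
  "G_energy \<alpha> Q E = perimeter E + ennreal (Q\<^sup>2) * I_energy \<alpha> (frontier E)"

definition ball_condition :: "real \<Rightarrow> 'a::euclidean_space set \<Rightarrow> bool" where
  "ball_condition \<delta> E \<longleftrightarrow>
     (\<forall>x \<in> frontier E.
        (\<exists>y. ball y \<delta> \<subseteq> E \<and> dist x y = \<delta>) \<and>
        (\<exists>z. ball z \<delta> \<subseteq> - E \<and> dist x z = \<delta>))"

definition K_class :: "real \<Rightarrow> 'a::euclidean_space set set" where
  "K_class \<delta> = {E. closed E \<and> ball_condition \<delta> E}"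

definition K_class_co :: "real \<Rightarrow> 'a::euclidean_space set set" where
  "K_class_co \<delta> = {E \<in> K_class \<delta>. connected E}"

end

theory Submission
  imports Defs "HOL-Probability.Helly_Selection" "HOL-Complex_Analysis.Great_Picard"
begin

text \<open>Direct method. Every point of a set with the \<open>\<delta>\<close>-ball condition lies near a ball of radius
  \<open>\<delta>\<close> inside the set, so a connected set of given volume has bounded diameter. After translating a
  minimizing sequence, Arzela--Ascoli makes the signed distances converge uniformly to some \<open>s\<close>, and
  the limit set is \<open>{s \<le> 0}\<close>. Limits of the tangent balls are tangent balls, whence \<open>{s = 0}\<close> is
  porous, hence a null set, and is exactly the boundary of the limit; this gives convergence of volumes
  and lower semicontinuity of the perimeter. For the Riesz energies, almost optimal measures are
  transported to the line by a Borel right inverse of a space-filling curve. There Helly's selection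
  theorem and Skorohod's representation apply; composing with the curve yields pointwise convergent
  random vectors, and Fatou's lemma finishes the proof.\<close>

subsection \<open>A space-filling curve with Borel right inverse\<close>

text \<open>Compactness comes from the class alone: tangent balls keep their radius \<delta> in the
  limit, so no energy bound enters and the infimum may be \<infinity>. The distance is signed
  because the distance to \<open>E n\<close> vanishes on all of \<open>E n\<close> and its limit
  could not tell interior from boundary; a limit of inner balls, by contrast, has s < 0 strictly.
  The detour through the line has this reason: Helly's and Skorohod's theorems concern measures on
  the reals. The curve is continuous and carries pointwise convergence back to the space, while its
  right inverse acts only on measures and may be discontinuous. Almost sure convergence then suits a
  kernel that is continuous with values in [0, \<infinity>], the diagonal included.\<close>

definition cantor_code :: "(nat \<Rightarrow> bool) \<Rightarrow> real" where
  "cantor_code a = (\<Sum>n. 2 * of_bool (a n) / 3 ^ Suc n)"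

text \<open>A continuous function of period 2, equal to 0 on [0, 1/3] and to 1 on [2/3, 4/3], in
  place of Schoenberg's piecewise linear one. A Cantor point lies in [0, 1/3] or [2/3, 1] according
  to its first ternary digit, so that digit is read off continuously.\<close>

definition cantor_digit :: "real \<Rightarrow> real" where
  "cantor_digit u = max 0 (min 1 (1/2 - cos (pi * u)))"

lemma sums_two_thirds_powers: "(\<lambda>n. 2 / 3 ^ Suc n :: real) sums 1"
  using sums_mult[OF geometric_sums[of "1/3::real"], of "2/3"]
  by (simp add: power_divide field_simps)

lemma summable_cantor_code: "summable (\<lambda>n. 2 * of_bool (a n) / 3 ^ Suc n :: real)"
  by (rule summable_comparison_test'[OF sums_summable[OF sums_two_thirds_powers], of 0])
     (auto simp: of_bool_def)

lemma cantor_code_nonneg: "0 \<le> cantor_code a"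
  unfolding cantor_code_def by (rule suminf_nonneg[OF summable_cantor_code]) auto

lemma cantor_code_le_1: "cantor_code a \<le> 1"
proof -
  have "cantor_code a \<le> (\<Sum>n. 2 / 3 ^ Suc n :: real)"
    unfolding cantor_code_def
    by (rule suminf_le[OF _ summable_cantor_code sums_summable[OF sums_two_thirds_powers]])
       (auto simp: of_bool_def)
  then show ?thesis
    using sums_two_thirds_powers sums_unique by fastforce
qed

lemma cantor_code_shift:
  "3 * cantor_code a = 2 * of_bool (a 0) + cantor_code (\<lambda>n. a (Suc n))"
proof -
  have "cantor_code a = 2 * of_bool (a 0) / 3 + (\<Sum>n. 2 * of_bool (a (Suc n)) / 3 ^ Suc (Suc n))"
    unfolding cantor_code_def
    by (subst suminf_split_initial_segment[OF summable_cantor_code, of _ 1]) simp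
  also have "(\<Sum>n. 2 * of_bool (a (Suc n)) / 3 ^ Suc (Suc n) :: real)
      = (\<Sum>n. (1/3) * (2 * of_bool (a (Suc n)) / 3 ^ Suc n))"
    by (rule suminf_cong) simp
  also have "\<dots> = (1/3) * cantor_code (\<lambda>n. a (Suc n))"
    unfolding cantor_code_def by (rule suminf_mult[OF summable_cantor_code])
  finally show ?thesis by simp
qed

text \<open>Multiplying by 3^n moves n ternary digits in front of the point. They are 0 or 2, so the
  integer part is even, a multiple of the period of \<open>cantor_digit\<close>.\<close>

lemma cantor_code_pow_shift:
  "\<exists>N::nat. 3 ^ n * cantor_code a = 2 * real N + cantor_code (\<lambda>k. a (n + k))"
proof (induction n)
  case 0
  show ?case by (rule exI[of _ 0]) simp
next
  case (Suc n)
  then obtain N where "3 ^ n * cantor_code a = 2 * real N + cantor_code (\<lambda>k. a (n + k))" by blast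
  then have "3 ^ Suc n * cantor_code a = 6 * real N + 3 * cantor_code (\<lambda>k. a (n + k))"
    by (simp add: algebra_simps)
  also have "\<dots> = 2 * real (3 * N + of_bool (a n)) + cantor_code (\<lambda>k. a (Suc n + k))"
    by (subst cantor_code_shift) simp
  finally show ?case by blast
qed

lemma cos_pi_ge_half: "0 \<le> u \<Longrightarrow> u \<le> 1/3 \<Longrightarrow> cos (pi * u) \<ge> 1/2"
  using cos_monotone_0_pi_le[of "pi * u" "pi / 3"] by (simp add: cos_60 mult_left_le)

lemma cantor_digit_pow_code: "cantor_digit (3 ^ n * cantor_code a) = of_bool (a n)"
proof -
  obtain N where N: "3 ^ n * cantor_code a = 2 * real N + cantor_code (\<lambda>k. a (n + k))"
    using cantor_code_pow_shift by blast
  define y where "y = cantor_code (\<lambda>k. a (n + k))"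
  have 1: "cos (pi * (3 ^ n * cantor_code a)) = cos (pi * y)"
  proof -
    have "pi * (3 ^ n * cantor_code a) = pi * y + 2 * pi * real N"
      unfolding N y_def by (simp add: algebra_simps)
    then show ?thesis
      using cos.plus_of_nat[of "pi * y" N] by (simp add: mult_ac)
  qed
  have 3: "3 * y = 2 * of_bool (a n) + cantor_code (\<lambda>k. a (n + Suc k))"
    unfolding y_def by (subst cantor_code_shift) simp
  show ?thesis
  proof (cases "a n")
    case True
    \<comment> \<open>A leading digit 2 puts \<open>y\<close> into [2/3, 1]; reflecting to 1 - y
      flips the sign of the cosine and reduces to the bound on [0, 1/3].\<close>
    then have "0 \<le> 1 - y" "1 - y \<le> 1/3"
      using 3 cantor_code_nonneg[of "\<lambda>k. a (n + Suc k)"] cantor_code_le_1[of "\<lambda>k. a (n + Suc k)"]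
      by auto
    then have "cos (pi * (1 - y)) \<ge> 1/2" by (rule cos_pi_ge_half)
    then have "cos (pi * y) \<le> - 1/2" by (simp add: algebra_simps cos_diff)
    with 1 True show ?thesis by (simp add: cantor_digit_def)
  next
    case False
    then have "0 \<le> y" "y \<le> 1/3"
      using 3 cantor_code_nonneg[of "\<lambda>k. a (n + Suc k)"] cantor_code_le_1[of "\<lambda>k. a (n + Suc k)"]
      by auto
    then have "cos (pi * y) \<ge> 1/2" by (rule cos_pi_ge_half)
    with 1 False show ?thesis by (simp add: cantor_digit_def)
  qed
qed

lemma binary_digits_sums:
  fixes x :: real
  assumes "0 \<le> x" "x < 1"
  shows "(\<lambda>k. of_bool (odd \<lfloor>2 ^ Suc k * x\<rfloor>) / 2 ^ Suc k) sums x"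
proof -
  \<comment> \<open>The induction works because floor(2y) - 2 floor(y) is 0 or 1 and has the parity
    of floor(2y). Its start uses floor(x) = 0, hence the half-open range of
    \<open>x\<close>.\<close>
  have part: "(\<Sum>k<n. (of_bool (odd \<lfloor>2 ^ Suc k * x\<rfloor>) :: real) / 2 ^ Suc k) = of_int \<lfloor>2 ^ n * x\<rfloor> / 2 ^ n" for n
  proof (induction n)
    case 0
    show ?case using assms floor_eq_iff[of x 0] by simp
  next
    case (Suc n)
    define y where "y = 2 ^ n * x"
    have "\<lfloor>2 * y\<rfloor> = 2 * \<lfloor>y\<rfloor> \<or> \<lfloor>2 * y\<rfloor> = 2 * \<lfloor>y\<rfloor> + 1" by linarith
    then have "\<lfloor>2 * y\<rfloor> = 2 * \<lfloor>y\<rfloor> + of_bool (odd \<lfloor>2 * y\<rfloor>)" by auto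
    then have "of_int \<lfloor>2 * y\<rfloor> = 2 * of_int \<lfloor>y\<rfloor> + (of_bool (odd \<lfloor>2 * y\<rfloor>) :: real)"
      by (metis of_int_add of_int_mult of_int_numeral of_int_of_bool)
    moreover have "2 ^ Suc n * x = 2 * y" by (simp add: y_def)
    ultimately show ?case
      using Suc by (simp add: y_def field_simps)
  qed
  have "(\<lambda>n. x - of_int \<lfloor>2 ^ n * x\<rfloor> / 2 ^ n) \<longlonglongrightarrow> 0"
  proof (rule Lim_null_comparison)
    show "(\<lambda>n. (1/2) ^ n :: real) \<longlonglongrightarrow> 0" by (simp add: LIMSEQ_power_zero)
    show "\<forall>\<^sub>F n in sequentially. norm (x - of_int \<lfloor>2 ^ n * x\<rfloor> / 2 ^ n) \<le> (1/2) ^ n"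
    proof (rule always_eventually, rule allI)
      fix n :: nat
      have "x - of_int \<lfloor>2 ^ n * x\<rfloor> / 2 ^ n = frac (2 ^ n * x) / 2 ^ n"
        by (simp add: frac_def field_simps)
      moreover have "\<bar>frac (2 ^ n * x)\<bar> \<le> 1"
        using frac_lt_1[of "2 ^ n * x"] frac_ge_0[of "2 ^ n * x"] by linarith
      ultimately show "norm (x - of_int \<lfloor>2 ^ n * x\<rfloor> / 2 ^ n) \<le> (1/2) ^ n"
        by (simp add: power_divide divide_right_mono)
    qed
  qed
  then have "(\<lambda>n. x - (x - of_int \<lfloor>2 ^ n * x\<rfloor> / 2 ^ n)) \<longlonglongrightarrow> x - 0"
    by (intro tendsto_diff tendsto_const)
  then show ?thesis unfolding sums_def part by simp
qed

lemma continuous_on_cantor_digit_series: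
  fixes e :: "nat \<Rightarrow> nat"
  shows "continuous_on UNIV (\<lambda>t. \<Sum>k. cantor_digit (3 ^ e k * t) / 2 ^ Suc k)"
proof -
  have "uniform_limit UNIV (\<lambda>n t. \<Sum>k<n. cantor_digit (3 ^ e k * t) / 2 ^ Suc k)
     (\<lambda>t. \<Sum>k. cantor_digit (3 ^ e k * t) / 2 ^ Suc k) sequentially"
  proof (rule Weierstrass_m_test)
    show "norm (cantor_digit (3 ^ e k * t) / 2 ^ Suc k) \<le> (1/2) ^ Suc k" for k t
      by (simp add: cantor_digit_def power_divide divide_right_mono field_simps)
    show "summable (\<lambda>k. (1/2) ^ Suc k :: real)"
      using summable_mult[OF summable_geometric[of "1/2::real"], of "1/2"] by simp
  qed
  then show ?thesis
    by (rule uniform_limit_theorem[rotated])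
       (auto intro!: always_eventually continuous_intros simp: cantor_digit_def)
qed

text \<open>Schoenberg's space-filling curve: the coordinates of \<open>c t\<close> have the binary digits coded in
  the ternary expansion of \<open>t\<close>.\<close>

lemma space_filling_curve:
  fixes R :: real
  assumes "R \<ge> 0"
  obtains c :: "real \<Rightarrow> 'a::euclidean_space" and h :: "'a \<Rightarrow> real"
  where "continuous_on UNIV c" "h \<in> borel_measurable borel"
    "\<And>x. 0 \<le> h x \<and> h x \<le> 1" "\<And>x. x \<in> cball 0 R \<Longrightarrow> c (h x) = x"
proof -
  \<comment> \<open>Position in the Cantor expansion that stores binary digit \<open>k\<close> of
    coordinate \<open>b\<close>; the pairing keeps all positions distinct.\<close>
  define e where "e b k = prod_encode (k, to_nat_on (Basis :: 'a set) b)" for b k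
  \<comment> \<open>Maps coordinates in [-R, R] into [0, 1): the denominator 2R + 1 instead of 2R
    keeps the value below 1 and covers R = 0.\<close>
  define u where "u b x = (x \<bullet> b + R) / (2 * R + 1)" for b x :: 'a
  define a where "a x n = (case prod_decode n of (k, j) \<Rightarrow>
      odd \<lfloor>2 ^ Suc k * u (from_nat_into Basis j) x\<rfloor>)" for x n
  define c where "c t = (\<Sum>b\<in>(Basis :: 'a set).
      ((2 * R + 1) * (\<Sum>k. cantor_digit (3 ^ e b k * t) / 2 ^ Suc k) - R) *\<^sub>R b)" for t
  define h where "h x = cantor_code (a x)" for x
  have c: "continuous_on UNIV c"
    unfolding c_def by (intro continuous_intros continuous_on_cantor_digit_series)
  have h: "h \<in> borel_measurable borel"
    unfolding h_def cantor_code_def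
  proof (rule borel_measurable_suminf)
    fix n
    show "(\<lambda>x. 2 * of_bool (a x n) / 3 ^ Suc n :: real) \<in> borel_measurable borel"
    proof (cases "prod_decode n")
      case (Pair k j)
      have "(\<lambda>x. u (from_nat_into Basis j) x) \<in> borel_measurable borel"
        unfolding u_def by measurable
      then have 1: "(\<lambda>x. \<lfloor>2 ^ Suc k * u (from_nat_into Basis j) x\<rfloor>) \<in> borel \<rightarrow>\<^sub>M count_space UNIV"
        by measurable
      have "(\<lambda>i::int. 2 * of_bool (odd i) / 3 ^ Suc n :: real) \<in> count_space UNIV \<rightarrow>\<^sub>M borel"
        by simp
      from measurable_compose[OF 1 this] show ?thesis
        by (simp add: a_def Pair)
    qed
  qed
  have ch: "c (h x) = x" if x: "x \<in> cball 0 R" for x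
  proof -
    have "(2 * R + 1) * (\<Sum>k. cantor_digit (3 ^ e b k * h x) / 2 ^ Suc k) - R = x \<bullet> b"
      if b: "b \<in> Basis" for b
    proof -
      have "\<bar>x \<bullet> b\<bar> \<le> R" using x b Basis_le_norm[of b x] by auto
      then have u: "0 \<le> u b x" "u b x < 1"
        using assms by (auto simp: u_def divide_simps)
      have "a x (e b k) = odd \<lfloor>2 ^ Suc k * u b x\<rfloor>" for k
        using b by (simp add: a_def e_def countable_finite)
      then have "(\<Sum>k. cantor_digit (3 ^ e b k * h x) / 2 ^ Suc k) = u b x"
        using sums_unique[OF binary_digits_sums[OF u]]
        by (simp add: h_def cantor_digit_pow_code)
      then show ?thesis using assms by (simp add: u_def)
    qed
    then show ?thesis
      by (simp add: c_def euclidean_representation)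
  qed
  show ?thesis
    by (rule that[OF c h _ ch]) (auto simp: h_def cantor_code_nonneg cantor_code_le_1)
qed

subsection \<open>Riesz energies\<close>

lemma skorohod_bounded:
  fixes \<mu> :: "nat \<Rightarrow> 'a::euclidean_space measure"
  assumes sets: "\<And>n. sets (\<mu> n) = sets borel"
    and prob: "\<And>n. prob_space (\<mu> n)"
    and supp: "\<And>n. emeasure (\<mu> n) (cball 0 R) = 1"
    and R: "R \<ge> 0"
  obtains r :: "nat \<Rightarrow> nat" and \<Omega> :: "real measure" and X :: "nat \<Rightarrow> real \<Rightarrow> 'a" and Y :: "real \<Rightarrow> 'a"
  where "strict_mono r" "prob_space \<Omega>" "\<And>n. X n \<in> borel_measurable \<Omega>" "Y \<in> borel_measurable \<Omega>"
    "\<And>n. distr \<Omega> borel (X n) = \<mu> (r n)"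
    "\<And>\<omega>. \<omega> \<in> space \<Omega> \<Longrightarrow> (\<lambda>n. X n \<omega>) \<longlonglongrightarrow> Y \<omega>"
proof -
  obtain c :: "real \<Rightarrow> 'a" and h where c: "continuous_on UNIV c" and h: "h \<in> borel_measurable borel"
    and h01: "\<And>x. 0 \<le> h x \<and> h x \<le> 1" and ch: "\<And>x. x \<in> cball 0 R \<Longrightarrow> c (h x) = x"
    using space_filling_curve[OF R] by blast
  have cm: "c \<in> borel_measurable borel" using c by (rule borel_measurable_continuous_onI)
  note sets [measurable_cong]
  note h [measurable] cm [measurable]
  define \<nu> where "\<nu> n = distr (\<mu> n) borel h" for n
  have rd: "real_distribution (\<nu> n)" for n
  proof -
    interpret prob_space "\<mu> n" by (rule prob)
    show ?thesis unfolding \<nu>_def by (rule real_distribution_distr) measurable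
  qed
  have "tight \<nu>"
    unfolding tight_def
  proof (intro conjI allI impI)
    show "real_distribution (\<nu> n)" for n by (rule rd)
    fix \<epsilon> :: real assume "\<epsilon> > 0"
    \<comment> \<open>Tightness is phrased with intervals open on the left; the left end -1 keeps a
      possible atom at 0 inside.\<close>
    have "measure (\<nu> n) {-1<..1} = 1" for n
    proof -
      interpret prob_space "\<mu> n" by (rule prob)
      have "measure (\<nu> n) {-1<..1} = measure (\<mu> n) (h -` {-1<..1} \<inter> space (\<mu> n))"
        unfolding \<nu>_def by (rule measure_distr) measurable
      also have "h -` {-1<..1} \<inter> space (\<mu> n) = space (\<mu> n)"
      proof -
        have "- 1 < h x" for x using h01[of x] by linarith
        then show ?thesis using h01 by auto
      qed
      finally show ?thesis by (simp add: prob_space)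
    qed
    then show "\<exists>a b. a < b \<and> (\<forall>n. 1 - \<epsilon> < measure (\<nu> n) {a<..b})"
      using \<open>\<epsilon> > 0\<close> by (intro exI[of _ "-1"] exI[of _ 1]) auto
  qed
  then obtain r M where r: "strict_mono (r :: nat \<Rightarrow> nat)" and M: "real_distribution M"
    "weak_conv_m (\<nu> \<circ> id \<circ> r) M"
    using tight_imp_convergent_subsubsequence[of \<nu> id] strict_mono_id by blast
  have "real_distribution ((\<nu> \<circ> id \<circ> r) n)" for n by (simp add: rd)
  from Skorohod[OF this M] obtain \<Omega> :: "real measure" and Ys Y where
    \<Omega>: "prob_space \<Omega>" and "\<forall>n. Ys n \<in> borel_measurable \<Omega>"
    "\<forall>n. distr \<Omega> borel (Ys n) = (\<nu> \<circ> id \<circ> r) n" "Y \<in> \<Omega> \<rightarrow>\<^sub>M lborel"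
    "\<forall>\<omega>\<in>space \<Omega>. (\<lambda>n. Ys n \<omega>) \<longlonglongrightarrow> Y \<omega>"
    by blast
  then have Ys: "Ys n \<in> borel_measurable \<Omega>" and dist: "distr \<Omega> borel (Ys n) = \<nu> (r n)"
    and Y: "Y \<in> borel_measurable \<Omega>"
    and lim: "\<omega> \<in> space \<Omega> \<Longrightarrow> (\<lambda>n. Ys n \<omega>) \<longlonglongrightarrow> Y \<omega>" for n \<omega>
    by simp_all
  note Ys [measurable] Y [measurable]
  show ?thesis
  proof (rule that[OF r \<Omega>, of "\<lambda>n \<omega>. c (Ys n \<omega>)" "\<lambda>\<omega>. c (Y \<omega>)"])
    fix n
    \<comment> \<open>Since \<open>c\<close> inverts \<open>h\<close> on the ball that carries all
      the mass, \<open>c\<close> turns the law of \<open>Ys n\<close> back into the original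
      measure, whatever \<open>c\<close> does elsewhere.\<close>
    have "distr \<Omega> borel (\<lambda>\<omega>. c (Ys n \<omega>)) = distr (distr \<Omega> borel (Ys n)) borel c"
      by (subst distr_distr) (auto simp: comp_def)
    also have "\<dots> = distr (\<mu> (r n)) borel (\<lambda>x. c (h x))"
      unfolding dist \<nu>_def by (subst distr_distr) (auto simp: comp_def)
    also have "\<dots> = distr (\<mu> (r n)) borel (\<lambda>x. x)"
    proof (rule distr_cong_AE)
      interpret prob_space "\<mu> (r n)" by (rule prob)
      have "AE x in \<mu> (r n). x \<in> cball 0 R"
      proof (subst prob_Collect_eq_1[symmetric])
        have "{x \<in> space (\<mu> (r n)). x \<in> cball 0 R} = cball 0 R"
          using sets_eq_imp_space_eq[OF sets[of "r n"]] by auto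
        then show "prob {x \<in> space (\<mu> (r n)). x \<in> cball 0 R} = 1"
          using supp[of "r n"] by (simp only: measure_def) simp
      qed (unfold mem_cball, measurable)
      then show "AE x in \<mu> (r n). c (h x) = x"
        by (rule AE_mp) (auto simp: ch)
    qed auto
    also have "\<dots> = \<mu> (r n)"
      by (rule distr_id2) (simp add: sets)
    finally show "distr \<Omega> borel (\<lambda>\<omega>. c (Ys n \<omega>)) = \<mu> (r n)" .
  next
    fix \<omega> assume "\<omega> \<in> space \<Omega>"
    then show "(\<lambda>n. c (Ys n \<omega>)) \<longlonglongrightarrow> c (Y \<omega>)"
      using c lim by (auto intro: continuous_on_tendsto_compose)
  qed measurable
qed

section \<open>The Riesz kernel and lower semicontinuity of the energy\<close>

definition riesz_kernel :: "real \<Rightarrow> 'a::euclidean_space \<Rightarrow> 'a \<Rightarrow> ennreal" where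
  "riesz_kernel \<alpha> x y = 1 / ennreal (norm (x - y) powr \<alpha>)"

lemma riesz_kernel_measurable:
  "(\<lambda>p. riesz_kernel \<alpha> (fst p) (snd p)) \<in> borel_measurable (borel \<Otimes>\<^sub>M borel)"
  unfolding riesz_kernel_def by measurable

text \<open>The diagonal is included: \<alpha> > 0 makes the power continuous at 0, and inversion is
  continuous on [0, \<infinity>], sending 0 to \<infinity>. Fatou's lemma thus applies to the kernel
  without truncation.\<close>

lemma riesz_kernel_tendsto:
  assumes "X \<longlonglongrightarrow> x" "Y \<longlonglongrightarrow> y" "\<alpha> > 0"
  shows "(\<lambda>n. riesz_kernel \<alpha> (X n) (Y n)) \<longlonglongrightarrow> riesz_kernel \<alpha> x y"
proof -
  have "(\<lambda>n. norm (X n - Y n) powr \<alpha>) \<longlonglongrightarrow> norm (x - y) powr \<alpha>"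
    using assms by (intro tendsto_powr2 tendsto_intros) auto
  then have "(\<lambda>n. ennreal (norm (X n - Y n) powr \<alpha>)) \<longlonglongrightarrow> ennreal (norm (x - y) powr \<alpha>)"
    by (rule tendsto_ennrealI)
  then have "(\<lambda>n. inverse (ennreal (norm (X n - Y n) powr \<alpha>))) \<longlonglongrightarrow> inverse (ennreal (norm (x - y) powr \<alpha>))"
    by (rule continuous_on_tendsto_compose[OF continuous_on_inverse_ennreal[OF continuous_on_id], of _ _ _ UNIV]) auto
  then show ?thesis by (simp add: riesz_kernel_def divide_ennreal_def)
qed

lemma riesz_energy_distr:
  fixes X :: "'b \<Rightarrow> 'a::euclidean_space"
  assumes "prob_space \<Omega>" and X [measurable]: "X \<in> borel_measurable \<Omega>"
  shows "riesz_energy \<alpha> (distr \<Omega> borel X) = (\<integral>\<^sup>+ s. \<integral>\<^sup>+ t. riesz_kernel \<alpha> (X s) (X t) \<partial>\<Omega> \<partial>\<Omega>)"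
proof -
  interpret prob_space \<Omega> by fact
  interpret D: prob_space "distr \<Omega> borel X" by (rule prob_space_distr) simp
  note riesz_kernel_measurable[measurable]
  have m: "(\<lambda>y. riesz_kernel \<alpha> x y) \<in> borel_measurable borel" for x :: 'a
    using measurable_compose[OF _ riesz_kernel_measurable[of \<alpha>], of "\<lambda>y. (x, y)"] by simp
  have "(\<lambda>x. \<integral>\<^sup>+ y. riesz_kernel \<alpha> x y \<partial>distr \<Omega> borel X) \<in> borel_measurable borel"
    using D.borel_measurable_nn_integral[of "\<lambda>x y. riesz_kernel \<alpha> x y" borel] riesz_kernel_measurable[of \<alpha>]
    by (simp add: case_prod_beta' cong: measurable_cong_sets sets_pair_measure_cong)
  then show ?thesis
    unfolding riesz_energy_def riesz_kernel_def[symmetric]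
    by (subst nn_integral_distr) (auto simp: m nn_integral_distr)
qed

lemma riesz_energy_restrict:
  fixes \<mu> :: "'a::euclidean_space measure"
  assumes sets: "sets \<mu> = sets borel" and A: "A \<in> sets borel" "emeasure \<mu> A = 1"
  shows "riesz_energy \<alpha> (density \<mu> (indicator A)) \<le> riesz_energy \<alpha> \<mu>"
proof -
  define \<mu>' where "\<mu>' = density \<mu> (indicator A)"
  note sets [measurable_cong] A(1) [measurable]
  have sets': "sets \<mu>' = sets borel" by (simp add: \<mu>'_def sets)
  have "emeasure \<mu>' (space \<mu>') = 1"
    using A sets_eq_imp_space_eq[OF sets]
    by (simp add: \<mu>'_def emeasure_density nn_integral_indicator sets)
  then interpret prob_space \<mu>' by (rule prob_spaceI)
  have m: "(\<lambda>y. riesz_kernel \<alpha> x y) \<in> borel_measurable borel" for x :: 'a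
    using measurable_compose[OF _ riesz_kernel_measurable[of \<alpha>], of "\<lambda>y. (x, y)"] by simp
  have m': "(\<lambda>x. \<integral>\<^sup>+ y. riesz_kernel \<alpha> x y \<partial>\<mu>') \<in> borel_measurable borel"
    using borel_measurable_nn_integral[of "\<lambda>x y. riesz_kernel \<alpha> x y" borel] riesz_kernel_measurable[of \<alpha>]
    by (simp add: case_prod_beta' sets' cong: measurable_cong_sets sets_pair_measure_cong)
  have le: "(\<integral>\<^sup>+ y. riesz_kernel \<alpha> x y \<partial>\<mu>') \<le> (\<integral>\<^sup>+ y. riesz_kernel \<alpha> x y \<partial>\<mu>)" for x
    unfolding \<mu>'_def using m
    by (subst nn_integral_density)
       (auto simp: measurable_cong_sets[OF sets refl] indicator_def intro!: nn_integral_mono)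
  have "riesz_energy \<alpha> \<mu>' = (\<integral>\<^sup>+ x. indicator A x * (\<integral>\<^sup>+ y. riesz_kernel \<alpha> x y \<partial>\<mu>') \<partial>\<mu>)"
    unfolding riesz_energy_def riesz_kernel_def[symmetric]
    by (subst (1) \<mu>'_def, subst nn_integral_density)
       (use m' in \<open>auto simp: measurable_cong_sets[OF sets refl]\<close>)
  also have "\<dots> \<le> (\<integral>\<^sup>+ x. (\<integral>\<^sup>+ y. riesz_kernel \<alpha> x y \<partial>\<mu>) \<partial>\<mu>)"
    using le by (intro nn_integral_mono) (auto simp: indicator_def)
  also have "\<dots> = riesz_energy \<alpha> \<mu>"
    by (simp add: riesz_energy_def riesz_kernel_def)
  finally show ?thesis by (simp add: \<mu>'_def)
qed

lemma I_energy_approx: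
  fixes A :: "'a::euclidean_space set"
  assumes "A \<in> sets borel" "I_energy \<alpha> A < top" "e > 0"
  obtains \<nu> where "sets \<nu> = sets borel" "prob_space \<nu>" "emeasure \<nu> A = 1"
    "riesz_energy \<alpha> \<nu> \<le> I_energy \<alpha> A + ennreal e"
proof -
  obtain \<mu> :: "'a measure" where \<mu>: "sets \<mu> = sets borel" "emeasure \<mu> A = 1"
    "riesz_energy \<alpha> \<mu> < I_energy \<alpha> A + ennreal e"
    using INF_approx_ennreal[OF \<open>e > 0\<close> I_energy_def[of \<alpha> A]] assms(2)
    by (auto simp del: not_gr_zero simp: less_top)
  note \<mu>(1) [measurable_cong] assms(1) [measurable]
  define \<nu> where "\<nu> = density \<mu> (indicator A)"
  have sets: "sets \<nu> = sets borel" by (simp add: \<nu>_def \<mu>)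
  have "emeasure \<nu> (space \<nu>) = 1"
    using assms(1) sets_eq_imp_space_eq[OF \<mu>(1)] \<mu>(2)
    by (simp add: \<nu>_def emeasure_density nn_integral_indicator \<mu>(1))
  then have "prob_space \<nu>" by (rule prob_spaceI)
  moreover have "emeasure \<nu> A = 1"
  proof -
    have "(\<lambda>x. indicator A x * indicator A x :: ennreal) = indicator A"
      by (auto simp: indicator_def)
    then show ?thesis
      using assms(1) \<mu> by (simp add: \<nu>_def emeasure_density)
  qed
  moreover have "riesz_energy \<alpha> \<nu> \<le> I_energy \<alpha> A + ennreal e"
    using riesz_energy_restrict[OF \<mu>(1) assms(1) \<mu>(2), of \<alpha>] \<mu>(3) unfolding \<nu>_def by simp
  ultimately show ?thesis using that sets by blast
qed

text \<open>The limit measure is carried by \<open>B\<close> because \<open>lim\<close> sends every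
  limit of points of the \<open>A n\<close>, along any subsequence, into \<open>B\<close>. Its
  energy is bounded by Fatou's lemma, once for each integral.\<close>

lemma I_energy_lower_semicontinuous:
  fixes A :: "nat \<Rightarrow> 'a::euclidean_space set"
  assumes \<alpha>: "\<alpha> > 0" and R: "R \<ge> 0"
    and A: "\<And>n. A n \<in> sets borel" "\<And>n. A n \<subseteq> cball 0 R" and B: "B \<in> sets borel"
    and lim: "\<And>r X x. strict_mono (r :: nat \<Rightarrow> nat) \<Longrightarrow> (\<And>n. X n \<in> A (r n)) \<Longrightarrow> X \<longlonglongrightarrow> x \<Longrightarrow> x \<in> B"
    and conv: "(\<lambda>n. I_energy \<alpha> (A n)) \<longlonglongrightarrow> i"
  shows "I_energy \<alpha> B \<le> i"
proof (cases "i = top")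
  case False
  then have "i < top" by (simp add: top.not_eq_extremum)
  \<comment> \<open>\<open>I_energy_approx\<close> asks for a finite infimum, hence the index shift
    by \<open>N\<close> from here on.\<close>
  then obtain N where N: "\<And>n. n \<ge> N \<Longrightarrow> I_energy \<alpha> (A n) < top"
    using order_tendstoD(2)[OF conv] unfolding eventually_sequentially by blast
  have "\<exists>\<nu>. sets \<nu> = sets borel \<and> prob_space \<nu> \<and> emeasure \<nu> (A (n + N)) = 1 \<and>
      riesz_energy \<alpha> \<nu> \<le> I_energy \<alpha> (A (n + N)) + ennreal (1 / real (Suc n))" for n
    by (rule I_energy_approx[OF A(1) N[of "n + N"], of "1 / real (Suc n)"]) auto
  then obtain \<nu> where \<nu>: "\<And>n. sets (\<nu> n) = sets borel" "\<And>n. prob_space (\<nu> n)"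
    "\<And>n. emeasure (\<nu> n) (A (n + N)) = 1"
    "\<And>n. riesz_energy \<alpha> (\<nu> n) \<le> I_energy \<alpha> (A (n + N)) + ennreal (1 / real (Suc n))"
    by metis
  have supp: "emeasure (\<nu> n) (cball 0 R) = 1" for n
  proof -
    interpret prob_space "\<nu> n" by (rule \<nu>)
    have "emeasure (\<nu> n) (A (n + N)) \<le> emeasure (\<nu> n) (cball 0 R)"
      by (rule emeasure_mono[OF A(2)]) (simp add: \<nu>)
    then show ?thesis using \<nu>(3)[of n] measure_le_1 by (simp add: antisym)
  qed
  obtain r and \<Omega> :: "real measure" and X :: "nat \<Rightarrow> real \<Rightarrow> 'a" and Y
    where r: "strict_mono (r :: nat \<Rightarrow> nat)" and \<Omega>: "prob_space \<Omega>"
      and X: "\<And>n. X n \<in> borel_measurable \<Omega>" and Y: "Y \<in> borel_measurable \<Omega>"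
      and dist: "\<And>n. distr \<Omega> borel (X n) = \<nu> (r n)"
      and XY: "\<And>\<omega>. \<omega> \<in> space \<Omega> \<Longrightarrow> (\<lambda>n. X n \<omega>) \<longlonglongrightarrow> Y \<omega>"
    by (rule skorohod_bounded[OF \<nu>(1) \<nu>(2) supp R]) (rule that)
  interpret prob_space \<Omega> by (rule \<Omega>)
  note X [measurable] Y [measurable] A(1) [measurable] B [measurable]
  have k: "(\<lambda>p. riesz_kernel \<alpha> (X n (fst p)) (X n (snd p))) \<in> borel_measurable (\<Omega> \<Otimes>\<^sub>M \<Omega>)" for n
    unfolding riesz_kernel_def by measurable
  have k1: "(\<lambda>t. riesz_kernel \<alpha> x (X n t)) \<in> borel_measurable \<Omega>" for n x
    unfolding riesz_kernel_def by measurable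
  have k2: "(\<lambda>s. \<integral>\<^sup>+ t. riesz_kernel \<alpha> (X n s) (X n t) \<partial>\<Omega>) \<in> borel_measurable \<Omega>" for n
    using borel_measurable_nn_integral[of "\<lambda>s t. riesz_kernel \<alpha> (X n s) (X n t)" \<Omega>] k
    by (simp add: case_prod_beta')
  have sm: "strict_mono (\<lambda>n. r n + N)" using r by (simp add: strict_mono_def)
  have "AE \<omega> in \<Omega>. X n \<omega> \<in> A (r n + N)" for n
  proof -
    have "emeasure \<Omega> (X n -` A (r n + N) \<inter> space \<Omega>) = 1"
      using \<nu>(3)[of "r n"] unfolding dist[symmetric] by (subst (asm) emeasure_distr) auto
    then have "prob {\<omega> \<in> space \<Omega>. X n \<omega> \<in> A (r n + N)} = 1"
      by (simp add: measure_def vimage_def Int_def conj_commute)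
    then show ?thesis by (subst (asm) prob_Collect_eq_1) auto
  qed
  \<comment> \<open>Countably many almost sure memberships hold simultaneously, so
    \<open>lim\<close> can be applied to almost every path.\<close>
  then have "AE \<omega> in \<Omega>. \<forall>n. X n \<omega> \<in> A (r n + N)" by (simp add: AE_all_countable)
  then have "AE \<omega> in \<Omega>. Y \<omega> \<in> B"
    by (rule AE_mp) (auto intro!: AE_I2 lim[OF sm] XY)
  then have "prob {\<omega> \<in> space \<Omega>. Y \<omega> \<in> B} = 1"
    by (subst prob_Collect_eq_1) auto
  then have "emeasure \<Omega> (Y -` B \<inter> space \<Omega>) = 1"
    by (simp add: emeasure_eq_measure vimage_def Int_def conj_commute)
  then have "emeasure (distr \<Omega> borel Y) B = 1" by (subst emeasure_distr) auto
  then have "I_energy \<alpha> B \<le> riesz_energy \<alpha> (distr \<Omega> borel Y)"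
    unfolding I_energy_def by (intro INF_lower) auto
  also have "\<dots> = (\<integral>\<^sup>+ s. \<integral>\<^sup>+ t. riesz_kernel \<alpha> (Y s) (Y t) \<partial>\<Omega> \<partial>\<Omega>)"
    by (rule riesz_energy_distr[OF \<Omega> Y])
  also have "\<dots> = (\<integral>\<^sup>+ s. \<integral>\<^sup>+ t. liminf (\<lambda>n. riesz_kernel \<alpha> (X n s) (X n t)) \<partial>\<Omega> \<partial>\<Omega>)"
    by (intro nn_integral_cong) (simp add: lim_imp_Liminf[OF _ riesz_kernel_tendsto[OF XY XY \<alpha>]])
  also have "\<dots> \<le> (\<integral>\<^sup>+ s. liminf (\<lambda>n. \<integral>\<^sup>+ t. riesz_kernel \<alpha> (X n s) (X n t) \<partial>\<Omega>) \<partial>\<Omega>)"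
    by (intro nn_integral_mono nn_integral_liminf k1)
  also have "\<dots> \<le> liminf (\<lambda>n. \<integral>\<^sup>+ s. \<integral>\<^sup>+ t. riesz_kernel \<alpha> (X n s) (X n t) \<partial>\<Omega> \<partial>\<Omega>)"
    by (rule nn_integral_liminf[OF k2])
  also have "\<dots> = liminf (\<lambda>n. riesz_energy \<alpha> (\<nu> (r n)))"
    by (simp add: riesz_energy_distr[OF \<Omega> X, symmetric] dist)
  also have "\<dots> \<le> liminf (\<lambda>n. I_energy \<alpha> (A (r n + N)) + ennreal (1 / real (Suc (r n))))"
    by (intro Liminf_mono always_eventually allI \<nu>)
  also have "\<dots> = i + 0"
  proof (rule lim_imp_Liminf[OF _ tendsto_add])
    show "(\<lambda>n. I_energy \<alpha> (A (r n + N))) \<longlonglongrightarrow> i"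
      using LIMSEQ_subseq_LIMSEQ[OF conv sm] by (simp add: comp_def)
    have "(\<lambda>n. 1 / real (Suc (r n))) \<longlonglongrightarrow> 0"
      using LIMSEQ_subseq_LIMSEQ[OF LIMSEQ_Suc[OF lim_1_over_n] r] by (simp add: comp_def)
    then show "(\<lambda>n. ennreal (1 / real (Suc (r n)))) \<longlonglongrightarrow> 0"
      using tendsto_ennrealI by force
  qed auto
  finally show ?thesis by simp
qed simp

subsection \<open>Perimeter and translations\<close>

text \<open>Uniqueness of the derivative identifies the choice term
  \<open>frechet_derivative\<close> with the continuous \<open>D\<close>, from which the divergence
  inherits its continuity.\<close>

lemma C1c_fields_divergence:
  fixes \<phi> :: "'a::euclidean_space \<Rightarrow> 'a"
  assumes "\<phi> \<in> C1c_fields"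
  obtains D :: "'a \<Rightarrow> 'a \<Rightarrow>\<^sub>L 'a" where "\<And>x. (\<phi> has_derivative blinfun_apply (D x)) (at x)" "continuous_on UNIV D"
    "\<And>x. divergence \<phi> x = (\<Sum>b\<in>Basis. blinfun_apply (D x) b \<bullet> b)"
proof -
  obtain D where D: "\<And>x. (\<phi> has_derivative blinfun_apply (D x)) (at x)" "continuous_on UNIV D"
    using assms unfolding C1c_fields_def by blast
  have "frechet_derivative \<phi> (at x) = blinfun_apply (D x)" for x
    using frechet_derivative_at[OF D(1)] by simp
  then have "divergence \<phi> x = (\<Sum>b\<in>Basis. blinfun_apply (D x) b \<bullet> b)" for x
    by (simp add: divergence_def)
  with D show ?thesis by (rule that)
qed

lemma continuous_on_divergence:
  fixes \<phi> :: "'a::euclidean_space \<Rightarrow> 'a"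
  assumes "\<phi> \<in> C1c_fields"
  shows "continuous_on UNIV (divergence \<phi>)"
proof -
  obtain D :: "'a \<Rightarrow> 'a \<Rightarrow>\<^sub>L 'a" where D: "continuous_on UNIV D"
    and eq: "\<And>x. divergence \<phi> x = (\<Sum>b\<in>Basis. blinfun_apply (D x) b \<bullet> b)"
    by (rule C1c_fields_divergence[OF assms]) blast
  have "divergence \<phi> = (\<lambda>x. \<Sum>b\<in>Basis. blinfun_apply (D x) b \<bullet> b)"
    using eq by blast
  then show ?thesis using D by (auto intro!: continuous_intros)
qed

text \<open>Dominated convergence: all \<open>E n\<close> lie in one ball, where \<open>f\<close> is
  bounded. Used with a divergence for the perimeter and with the constant 1 for the volume.\<close>

lemma tendsto_set_integral:
  fixes f :: "'a::euclidean_space \<Rightarrow> real"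
  assumes f: "continuous_on UNIV f"
    and E: "\<And>n. E n \<in> sets lebesgue" "\<And>n. E n \<subseteq> cball 0 R" and F: "F \<in> sets lebesgue"
    and lim: "AE x in lebesgue. (\<lambda>n. indicator (E n) x :: real) \<longlonglongrightarrow> indicator F x"
  shows "(\<lambda>n. LINT x:E n|lebesgue. f x) \<longlonglongrightarrow> (LINT x:F|lebesgue. f x)"
proof -
  have "compact (f ` cball 0 R)"
    by (rule compact_continuous_image[OF continuous_on_subset[OF f]]) auto
  then obtain B where B: "\<And>x. x \<in> cball 0 R \<Longrightarrow> \<bar>f x\<bar> \<le> B"
    using compact_imp_bounded[of "f ` cball 0 R"] unfolding bounded_iff by fastforce
  have fm [measurable]: "f \<in> borel_measurable lebesgue"
    using borel_measurable_continuous_onI[OF f] by (simp add: measurable_completion)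
  note E(1) [measurable] F [measurable]
  show ?thesis
    unfolding set_lebesgue_integral_def
  proof (rule integral_dominated_convergence[where w = "\<lambda>x. B * indicator (cball 0 R) x"])
    show "(\<lambda>x. indicator F x *\<^sub>R f x) \<in> borel_measurable lebesgue" by measurable
    show "(\<lambda>x. indicator (E n) x *\<^sub>R f x) \<in> borel_measurable lebesgue" for n by measurable
    show "integrable lebesgue (\<lambda>x. B * indicator (cball (0::'a) R) x)"
      by (intro integrable_mult_right integrable_real_indicator)
         (use emeasure_bounded_finite[of "cball (0::'a) R"] in auto)
    show "AE x in lebesgue. (\<lambda>n. indicator (E n) x *\<^sub>R f x) \<longlonglongrightarrow> indicator F x *\<^sub>R f x"
      using lim by eventually_elim (intro tendsto_intros)
    show "AE x in lebesgue. norm (indicator (E n) x *\<^sub>R f x) \<le> B * indicator (cball 0 R) x" for n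
    proof (rule AE_I2)
      fix x
      show "norm (indicator (E n) x *\<^sub>R f x) \<le> B * indicator (cball 0 R) x"
        using B[of x] E(2)[of n] by (auto simp: indicator_def subset_eq abs_ge_zero[THEN order_trans])
    qed
  qed
qed

text \<open>For each fixed test field the integral of the divergence converges, and a supremum of
  such functionals is lower semicontinuous.\<close>

lemma perimeter_lower_semicontinuous:
  fixes F :: "'a::euclidean_space set"
  assumes E: "\<And>n. E n \<in> sets lebesgue" "\<And>n. E n \<subseteq> cball 0 R" and F: "F \<in> sets lebesgue"
    and lim: "AE x in lebesgue. (\<lambda>n. indicator (E n) x :: real) \<longlonglongrightarrow> indicator F x"
    and conv: "(\<lambda>n. perimeter (E n)) \<longlonglongrightarrow> p"
  shows "perimeter F \<le> p"
  unfolding perimeter_def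
proof (rule SUP_least)
  fix \<phi> :: "'a \<Rightarrow> 'a" assume \<phi>: "\<phi> \<in> {\<phi> \<in> C1c_fields. \<forall>x. norm (\<phi> x) \<le> 1}"
  then have "continuous_on UNIV (divergence \<phi>)" by (simp add: continuous_on_divergence)
  from tendsto_set_integral[OF this E F lim]
  have "(\<lambda>n. ennreal (LINT x:E n|lebesgue. divergence \<phi> x)) \<longlonglongrightarrow> ennreal (LINT x:F|lebesgue. divergence \<phi> x)"
    by (rule tendsto_ennrealI)
  moreover have "ennreal (LINT x:E n|lebesgue. divergence \<phi> x) \<le> perimeter (E n)" for n
    unfolding perimeter_def using \<phi> by (rule SUP_upper)
  ultimately show "ennreal (LINT x:F|lebesgue. divergence \<phi> x) \<le> p"
    using conv by (intro LIMSEQ_le) auto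
qed

section \<open>Invariance under translations\<close>

lemma perimeter_translation_le:
  fixes E :: "'a::euclidean_space set"
  assumes E: "closed E"
  shows "perimeter ((+) a ` E) \<le> perimeter E"
  unfolding perimeter_def
proof (rule SUP_mono)
  fix \<phi> :: "'a \<Rightarrow> 'a" assume \<phi>: "\<phi> \<in> {\<phi> \<in> C1c_fields. \<forall>x. norm (\<phi> x) \<le> 1}"
  \<comment> \<open>The field pulled back by the translation is a competitor for \<open>E\<close>
    with the same integral. The reverse inequality comes from translating by
    \<open>- a\<close>.\<close>
  define \<psi> where "\<psi> x = \<phi> (a + x)" for x
  obtain D where D: "\<And>x. (\<phi> has_derivative blinfun_apply (D x)) (at x)" "continuous_on UNIV D"
    and eq: "\<And>x. divergence \<phi> x = (\<Sum>b\<in>Basis. blinfun_apply (D x) b \<bullet> b)"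
    by (rule C1c_fields_divergence[of \<phi>]) (use \<phi> in \<open>auto intro: that\<close>)
  have D\<psi>: "(\<psi> has_derivative blinfun_apply (D (a + x))) (at x)" for x
  proof -
    have "((\<lambda>x. a + x) has_derivative (\<lambda>x. x)) (at x)"
      by (auto intro!: derivative_eq_intros)
    from has_derivative_compose[OF this D(1)] show ?thesis by (simp add: \<psi>_def[abs_def])
  qed
  have "continuous_on UNIV (\<lambda>x. D (a + x))"
    by (rule continuous_on_compose2[OF D(2)]) (auto intro!: continuous_intros)
  moreover have "compact (closure {x. \<psi> x \<noteq> 0})"
  proof -
    have "{x. \<psi> x \<noteq> 0} = (+) (- a) ` {x. \<phi> x \<noteq> 0}"
      by (force simp: \<psi>_def image_iff intro: exI[of _ "a + _"])
    then have "closure {x. \<psi> x \<noteq> 0} = (+) (- a) ` closure {x. \<phi> x \<noteq> 0}"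
      by (simp only: closure_translation)
    moreover have "compact (closure {x. \<phi> x \<noteq> 0})"
      using \<phi> unfolding C1c_fields_def by blast
    ultimately show ?thesis by (simp only: compact_translation)
  qed
  ultimately have "\<psi> \<in> {\<phi> \<in> C1c_fields. \<forall>x. norm (\<phi> x) \<le> 1}"
    using D\<psi> \<phi> unfolding C1c_fields_def by (auto simp: \<psi>_def intro!: exI[of _ "\<lambda>x. D (a + x)"])
  moreover have "(LINT x:(+) a ` E|lebesgue. divergence \<phi> x) = (LINT x:E|lebesgue. divergence \<psi> x)"
  proof -
    have div: "divergence \<psi> x = divergence \<phi> (a + x)" for x
      using frechet_derivative_at[OF D\<psi>[of x]] by (simp add: eq divergence_def[of \<psi>])
    have [measurable]: "divergence \<phi> \<in> borel_measurable borel"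
      using \<phi> by (intro borel_measurable_continuous_onI continuous_on_divergence) simp
    have [measurable]: "E \<in> sets borel" "(+) a ` E \<in> sets borel"
      using E by (auto intro: borel_closed closed_translation)
    have "(LINT x:(+) a ` E|lebesgue. divergence \<phi> x)
        = (LINT x|lborel. indicator ((+) a ` E) x *\<^sub>R divergence \<phi> x)"
      unfolding set_lebesgue_integral_def by (subst integral_completion) auto
    also have "\<dots> = (LINT x|distr lborel borel ((+) a). indicator ((+) a ` E) x *\<^sub>R divergence \<phi> x)"
      by (subst lborel_distr_plus) simp
    also have "\<dots> = (LINT x|lborel. indicator ((+) a ` E) (a + x) *\<^sub>R divergence \<phi> (a + x))"
      by (subst integral_distr) auto
    also have "\<dots> = (LINT x|lborel. indicator E x *\<^sub>R divergence \<psi> x)"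
      by (intro Bochner_Integration.integral_cong) (auto simp: div indicator_def)
    also have "\<dots> = (LINT x:E|lebesgue. divergence \<psi> x)"
      unfolding set_lebesgue_integral_def div by (subst integral_completion) auto
    finally show ?thesis .
  qed
  ultimately show "\<exists>\<psi>\<in>{\<phi> \<in> C1c_fields. \<forall>x. norm (\<phi> x) \<le> 1}.
      ennreal (LINT x:(+) a ` E|lebesgue. divergence \<phi> x) \<le> ennreal (LINT x:E|lebesgue. divergence \<psi> x)"
    by auto
qed

lemma I_energy_translation_le:
  fixes A :: "'a::euclidean_space set"
  assumes A: "closed A"
  shows "I_energy \<alpha> ((+) a ` A) \<le> I_energy \<alpha> A"
proof (cases "I_energy \<alpha> A < top")
  case True
  have Ab: "A \<in> sets borel" "(+) a ` A \<in> sets borel"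
    using A by (auto intro: borel_closed closed_translation)
  show ?thesis
  proof (rule ennreal_le_epsilon)
    fix e :: real assume e: "0 < e"
    obtain \<nu> :: "'a measure" where \<nu>: "sets \<nu> = sets borel" "prob_space \<nu>" "emeasure \<nu> A = 1"
      "riesz_energy \<alpha> \<nu> \<le> I_energy \<alpha> A + ennreal e"
      by (rule I_energy_approx[OF Ab(1) True e]) (rule that)
    have m: "(+) a \<in> borel_measurable \<nu>"
      by (simp add: measurable_cong_sets[OF \<nu>(1) refl])
    have "(+) a -` (+) a ` A \<inter> space \<nu> = A"
      using sets_eq_imp_space_eq[OF \<nu>(1)] by auto
    then have "emeasure (distr \<nu> borel ((+) a)) ((+) a ` A) = 1"
      using \<nu>(3) by (subst emeasure_distr[OF m Ab(2)]) simp
    then have "I_energy \<alpha> ((+) a ` A) \<le> riesz_energy \<alpha> (distr \<nu> borel ((+) a))"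
      unfolding I_energy_def by (intro INF_lower) auto
    also have "\<dots> = riesz_energy \<alpha> \<nu>"
      by (subst riesz_energy_distr[OF \<nu>(2) m]) (simp add: riesz_energy_def riesz_kernel_def)
    finally show "I_energy \<alpha> ((+) a ` A) \<le> I_energy \<alpha> A + ennreal e" using \<nu>(4) by simp
  qed
qed (simp add: not_less top.extremum_unique)

lemma perimeter_translation:
  fixes E :: "'a::euclidean_space set"
  assumes "closed E"
  shows "perimeter ((+) a ` E) = perimeter E"
proof -
  have "(+) (- a) ` (+) a ` E = E" by (simp add: image_image)
  then show ?thesis
    using perimeter_translation_le[OF assms, of a]
      perimeter_translation_le[OF closed_translation[OF assms], of "- a" a] by simp
qed

lemma I_energy_translation:
  fixes A :: "'a::euclidean_space set"
  assumes "closed A"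
  shows "I_energy \<alpha> ((+) a ` A) = I_energy \<alpha> A"
proof -
  have "(+) (- a) ` (+) a ` A = A" by (simp add: image_image)
  then show ?thesis
    using I_energy_translation_le[OF assms, of \<alpha> a]
      I_energy_translation_le[OF closed_translation[OF assms], of \<alpha> "- a" a] by simp
qed

lemma ball_condition_translation:
  fixes E :: "'a::euclidean_space set"
  assumes "ball_condition \<delta> E"
  shows "ball_condition \<delta> ((+) a ` E)"
  unfolding ball_condition_def frontier_translation
proof
  fix x assume "x \<in> (+) a ` frontier E"
  then obtain w where w: "w \<in> frontier E" "x = a + w" by auto
  then obtain y z where yz: "ball y \<delta> \<subseteq> E" "dist w y = \<delta>" "ball z \<delta> \<subseteq> - E" "dist w z = \<delta>"
    using assms unfolding ball_condition_def by blast
  have "ball (a + y) \<delta> \<subseteq> (+) a ` E"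
    unfolding ball_translation by (rule image_mono[OF yz(1)])
  moreover have "ball (a + z) \<delta> \<subseteq> - (+) a ` E"
    unfolding ball_translation using yz(3) by (auto simp: subset_eq dist_norm algebra_simps)
  moreover have "dist x (a + y) = \<delta>" "dist x (a + z) = \<delta>"
    using w yz by simp_all
  ultimately show "(\<exists>y. ball y \<delta> \<subseteq> (+) a ` E \<and> dist x y = \<delta>) \<and> (\<exists>z. ball z \<delta> \<subseteq> - (+) a ` E \<and> dist x z = \<delta>)"
    by blast
qed

lemma K_class_co_translation:
  fixes E :: "'a::euclidean_space set"
  assumes "E \<in> K_class_co \<delta>"
  shows "(+) a ` E \<in> K_class_co \<delta>"
  using assms ball_condition_translation[of \<delta> E a]
  by (auto simp: K_class_co_def K_class_def closed_translation connected_continuous_image continuous_intros)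

subsection \<open>Geometry of the ball condition\<close>

text \<open>If \<open>ball x \<delta>\<close> leaves \<open>E\<close>, it meets the frontier at some
  p, and the inner tangent ball at p has its centre within \<delta> + \<delta> of
  \<open>x\<close>.\<close>

lemma ball_condition_near_ball:
  fixes E :: "'a::euclidean_space set"
  assumes "ball_condition \<delta> E" "x \<in> E" "\<delta> > 0"
  obtains y where "ball y \<delta> \<subseteq> E" "dist x y < 2 * \<delta>"
proof (cases "ball x \<delta> \<subseteq> E")
  case True
  then show ?thesis using that[of x] assms(3) by simp
next
  case False
  then have "ball x \<delta> \<inter> frontier E \<noteq> {}"
  proof (intro connected_Int_frontier)
    show "ball x \<delta> \<inter> E \<noteq> {}" using assms centre_in_ball by blast
  qed auto
  then obtain p where p: "p \<in> frontier E" "dist x p < \<delta>" by auto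
  then obtain y where "ball y \<delta> \<subseteq> E" "dist p y = \<delta>"
    using assms(1) unfolding ball_condition_def by blast
  then show ?thesis using that[of y] p dist_triangle[of x y p] by simp
qed

text \<open>A packing argument. By connectedness the norm takes on \<open>E\<close> each value
  6\<delta>k below that of a far point, and near each such point sits a \<delta>-ball inside
  \<open>E\<close>. The norms of the centres err by less than 2\<delta>, so the spacing 6\<delta>
  leaves at least 2\<delta> between centres; \<open>K\<close> disjoint balls have too much
  volume.\<close>

lemma ball_condition_connected_bounded:
  fixes E :: "'a::euclidean_space set"
  assumes bc: "ball_condition \<delta> E" and conn: "connected E" and \<delta>: "\<delta> > 0"
    and E: "E \<in> sets lebesgue" and m: "emeasure lebesgue E \<le> ennreal m" and "0 \<in> E"
    and "0 \<le> m" and K: "real K * measure lebesgue (ball (0::'a) \<delta>) > m"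
  shows "E \<subseteq> cball 0 (6 * \<delta> * real K)"
proof
  fix x assume x: "x \<in> E"
  show "x \<in> cball 0 (6 * \<delta> * real K)"
  proof (rule ccontr)
    assume "x \<notin> cball 0 (6 * \<delta> * real K)"
    then have far: "6 * \<delta> * real K < norm x" by simp
    have "\<exists>y. ball y \<delta> \<subseteq> E \<and> \<bar>norm y - 6 * \<delta> * real k\<bar> < 2 * \<delta>" if "k < K" for k
    proof -
      have "connected (norm ` E)" by (intro connected_continuous_image continuous_intros conn)
      moreover have "0 \<in> norm ` E" using \<open>0 \<in> E\<close> by force
      moreover have "norm x \<in> norm ` E" using x by simp
      moreover have "6 * \<delta> * real k \<le> norm x"
        using far that \<delta> by (smt (verit) mult_left_mono of_nat_less_iff)
      ultimately have "6 * \<delta> * real k \<in> norm ` E"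
        using \<delta> by (auto intro: connectedD_interval[of "norm ` E" 0 "norm x"])
      then obtain w where w: "w \<in> E" "norm w = 6 * \<delta> * real k" by auto
      obtain y where "ball y \<delta> \<subseteq> E" "dist w y < 2 * \<delta>"
        by (rule ball_condition_near_ball[OF bc w(1) \<delta>])
      then show ?thesis
        using w(2) norm_triangle_ineq3[of w y] by (intro exI[of _ y]) (auto simp: dist_norm)
    qed
    then obtain y where y: "\<And>k. k < K \<Longrightarrow> ball (y k) \<delta> \<subseteq> E"
      "\<And>k. k < K \<Longrightarrow> \<bar>norm (y k) - 6 * \<delta> * real k\<bar> < 2 * \<delta>"
      by metis
    have disj: "disjoint_family_on (\<lambda>k. ball (y k) \<delta>) {..<K}"
      unfolding disjoint_family_on_def
    proof (intro ballI impI)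
      fix i j assume ij: "i \<in> {..<K}" "j \<in> {..<K}" "i \<noteq> j"
      have "\<bar>real i - real j\<bar> \<ge> 1" using ij(3) by linarith
      then have "6 * \<delta> \<le> \<bar>6 * \<delta> * real i - 6 * \<delta> * real j\<bar>"
        using \<delta> by (simp add: abs_mult flip: right_diff_distrib)
      then have "2 * \<delta> \<le> norm (y i - y j)"
        using y(2)[of i] y(2)[of j] ij norm_triangle_ineq3[of "y i" "y j"] by auto
      then show "ball (y i) \<delta> \<inter> ball (y j) \<delta> = {}"
        by (intro disjoint_ballI) (simp add: dist_norm)
    qed
    have "ennreal (real K * measure lebesgue (ball (0::'a) \<delta>)) = (\<Sum>k<K. emeasure lebesgue (ball (y k) \<delta>))"
    proof -
      have "emeasure lebesgue (ball (y k) \<delta>) = ennreal (measure lebesgue (ball (0::'a) \<delta>))" for k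
        using \<delta> by (simp add: emeasure_ball content_ball)
      then show ?thesis by (simp add: ennreal_mult ennreal_of_nat_eq_real_of_nat)
    qed
    also have "\<dots> = emeasure lebesgue (\<Union>k<K. ball (y k) \<delta>)"
      using disj by (intro sum_emeasure) auto
    also have "\<dots> \<le> emeasure lebesgue E"
      using y(1) E by (intro emeasure_mono) auto
    also have "\<dots> \<le> ennreal m" by (rule m)
    finally show False using K \<open>0 \<le> m\<close> by (simp add: ennreal_le_iff)
  qed
qed

text \<open>A fixed proportion of each small ball centred in \<open>Z\<close> misses \<open>Z\<close>, so by a Vitali covering
  \<open>|Z| \<le> 10\<^sup>d |U - Z|\<close> for every open \<open>U \<supseteq> Z\<close>.\<close>

lemma negligible_if_external_tangent_balls:
  fixes Z :: "'a::euclidean_space set"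
  assumes Z: "compact Z" and \<delta>: "\<delta> > 0"
    and tb: "\<And>x. x \<in> Z \<Longrightarrow> \<exists>y. dist x y = \<delta> \<and> ball y \<delta> \<inter> Z = {}"
  shows "negligible Z"
proof -
  \<comment> \<open>Ratio of the volumes of balls of radii 10r and r: the Vitali lemma enlarges the
    balls of radius 2r five times.\<close>
  define c where "c = (10::real) ^ DIM('a)"
  have Zl: "Z \<in> lmeasurable" by (rule lmeasurable_compact[OF Z])
  have *: "measure lebesgue Z \<le> c * e" if e: "e > 0" for e
  proof -
    obtain U where U: "open U" "Z \<subseteq> U" "U - Z \<in> lmeasurable" "emeasure lebesgue (U - Z) < ennreal e"
      using sets_lebesgue_outer_open[OF fmeasurableD[OF Zl] e] by blast
    obtain \<epsilon> where \<epsilon>: "\<epsilon> > 0" "(\<Union>x\<in>Z. ball x \<epsilon>) \<subseteq> U"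
      using compact_subset_open_imp_ball_epsilon_subset[OF Z U(1,2)] by blast
    \<comment> \<open>One bound keeps \<open>ball x (2 * r)\<close> inside \<open>U\<close>, the
      other lets a ball of radius r fit into a tangent ball of radius \<delta>.\<close>
    define r where "r = min (\<epsilon> / 2) \<delta>"
    have r: "r > 0" "r \<le> \<delta>" "2 * r \<le> \<epsilon>" using \<epsilon> \<delta> by (auto simp: r_def)
    have "Z \<subseteq> (\<Union>x\<in>Z. ball x (2 * r))" using r by force
    then obtain K where K: "K \<subseteq> Z" "finite K" "Z \<subseteq> (\<Union>x\<in>K. ball x (2 * r))"
      using compactE_image[OF Z, of Z "\<lambda>x. ball x (2 * r)"] by (metis open_ball)
    obtain C where C: "C \<subseteq> K" "pairwise (\<lambda>i j. disjnt (ball i (2 * r)) (ball j (2 * r))) C"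
      "Z \<subseteq> (\<Union>i\<in>C. ball i (5 * (2 * r)))"
      by (rule Vitali_covering_lemma_balls[OF K(3), where B = "2 * r"]) (use r in auto)
    have fC: "finite C" using C(1) K(2) finite_subset by blast
    have "\<exists>y. ball y r \<subseteq> ball x (2 * r) \<and> ball y r \<inter> Z = {}" if "x \<in> C" for x
    proof -
      obtain z where z: "dist x z = \<delta>" "ball z \<delta> \<inter> Z = {}" using tb C(1) K(1) \<open>x \<in> C\<close> by blast
      \<comment> \<open>Moving from \<open>x\<close> by r towards the centre \<open>z\<close> makes
        \<open>ball y r\<close> internally tangent to \<open>ball z \<delta>\<close> at
        \<open>x\<close>, hence disjoint from \<open>Z\<close>.\<close>
      define y where "y = x + (r / \<delta>) *\<^sub>R (z - x)"
      have nz: "norm (z - x) = \<delta>" using z by (simp add: dist_norm norm_minus_commute)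
      have "dist y x = r" using nz \<delta> r by (simp add: y_def dist_norm)
      then have "ball y r \<subseteq> ball x (2 * r)"
        by (auto simp: ball_subset_ball_iff)
      moreover have "dist y z = \<delta> - r"
      proof -
        have "z - y = (1 - r / \<delta>) *\<^sub>R (z - x)" by (simp add: y_def algebra_simps)
        then have "norm (z - y) = \<bar>1 - r / \<delta>\<bar> * \<delta>" using nz by simp
        also have "\<dots> = \<delta> - r" using r \<delta> by (simp add: abs_of_nonneg field_simps)
        finally show ?thesis by (simp add: dist_norm norm_minus_commute)
      qed
      then have "ball y r \<subseteq> ball z \<delta>" by (auto simp: ball_subset_ball_iff)
      ultimately show ?thesis using z(2) by blast
    qed
    then obtain y where y: "\<And>x. x \<in> C \<Longrightarrow> ball (y x) r \<subseteq> ball x (2 * r)"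
      "\<And>x. x \<in> C \<Longrightarrow> ball (y x) r \<inter> Z = {}"
      by metis
    have "measure lebesgue Z \<le> measure lebesgue (\<Union>i\<in>C. ball i (10 * r))"
      using C(3) Zl fC by (intro measure_mono_fmeasurable) (auto intro: fmeasurable.finite_UN fmeasurableD)
    also have "\<dots> \<le> (\<Sum>i\<in>C. measure lebesgue (ball i (10 * r)))"
      by (rule measure_UNION_le[OF fC]) auto
    also have "\<dots> = c * (\<Sum>i\<in>C. measure lebesgue (ball (y i) r))"
      using r by (simp add: content_ball c_def power_mult_distrib)
    also have "(\<Sum>i\<in>C. measure lebesgue (ball (y i) r)) = measure lebesgue (\<Union>i\<in>C. ball (y i) r)"
    proof (rule measure_UNION'[symmetric])
      show "pairwise (\<lambda>i j. disjnt (ball (y i) r) (ball (y j) r)) C"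
      proof (rule pairwiseI)
        fix i j assume ij: "i \<in> C" "j \<in> C" "i \<noteq> j"
        then have "ball i (2 * r) \<inter> ball j (2 * r) = {}"
          using C(2) by (auto simp: pairwise_def disjnt_def)
        then show "disjnt (ball (y i) r) (ball (y j) r)"
          using y(1)[OF ij(1)] y(1)[OF ij(2)] unfolding disjnt_def by blast
      qed
    qed (use fC in auto)
    also have "\<dots> \<le> measure lebesgue (U - Z)"
    proof (rule measure_mono_fmeasurable[OF _ _ U(3)])
      have "ball x (2 * r) \<subseteq> U" if "x \<in> C" for x
        using that \<epsilon>(2) r C(1) K(1) subset_ball[of "2 * r" \<epsilon> x] by blast
      then show "(\<Union>i\<in>C. ball (y i) r) \<subseteq> U - Z" using y by blast
    qed (use fC in auto)
    also have "\<dots> \<le> e"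
      unfolding measure_def using U(4) e by (intro enn2real_leI) (auto intro: less_imp_le)
    finally show ?thesis by (simp add: c_def)
  qed
  have "measure lebesgue Z \<le> 0"
  proof (rule field_le_epsilon)
    fix e :: real assume "e > 0"
    then show "measure lebesgue Z \<le> 0 + e"
      using *[of "e / c"] by (simp add: c_def)
  qed
  then show ?thesis
    using Zl by (simp add: negligible_iff_measure measure_le_0_iff)
qed

section \<open>Signed distance to a set\<close>

definition signed_dist :: "'a::euclidean_space set \<Rightarrow> 'a \<Rightarrow> real" where
  "signed_dist E x = infdist x E - infdist x (- E)"

lemma signed_dist_lipschitz: "\<bar>signed_dist E x - signed_dist E y\<bar> \<le> 2 * dist x y"
  using infdist_triangle_abs[of x E y] infdist_triangle_abs[of x "- E" y]
  unfolding signed_dist_def by linarith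

lemma signed_dist_le_0: "x \<in> E \<Longrightarrow> signed_dist E x \<le> 0"
  by (simp add: signed_dist_def infdist_nonneg)

lemma signed_dist_neg_imp_mem: "signed_dist E x < 0 \<Longrightarrow> x \<in> E"
  using infdist_nonneg[of x E] infdist_zero[of x "- E"] unfolding signed_dist_def by fastforce

lemma infdist_ge_if_ball_disjoint:
  assumes "A \<noteq> {}" "ball x r \<inter> A = {}"
  shows "r \<le> infdist x A"
  using assms by (auto simp: infdist_def intro!: cINF_greatest simp: disjoint_iff not_less)

text \<open>\<open>infdist\<close> to the empty set is 0 by convention, so the signed distance to
  \<open>UNIV\<close> vanishes identically. Hence the condition on \<open>E\<close> here, and dually
  in the next lemma.\<close>

lemma signed_dist_le_if_ball_subset:
  assumes "E \<noteq> UNIV" "ball x r \<subseteq> E" "r > 0"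
  shows "signed_dist E x \<le> - r"
proof -
  have "r \<le> infdist x (- E)" using assms by (intro infdist_ge_if_ball_disjoint) auto
  moreover have "infdist x E = 0" using assms centre_in_ball by (intro infdist_zero) blast
  ultimately show ?thesis by (simp add: signed_dist_def)
qed

lemma signed_dist_ge_if_ball_disjoint:
  assumes "E \<noteq> {}" "ball x r \<subseteq> - E" "r > 0"
  shows "signed_dist E x \<ge> r"
proof -
  have "- E \<noteq> UNIV" using assms(1) by blast
  from signed_dist_le_if_ball_subset[OF this assms(2,3)] show ?thesis
    by (simp add: signed_dist_def)
qed

lemma signed_dist_frontier:
  assumes "x \<in> frontier E"
  shows "signed_dist E x = 0"
proof -
  have "x \<in> closure E" "x \<in> closure (- E)" using assms by (auto simp: frontier_closures)
  then show ?thesis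
    by (metis closure_empty diff_zero empty_iff in_closure_iff_infdist_zero signed_dist_def)
qed

text \<open>A ball of radius \<open>r\<close> inside \<open>E\<close> or inside its complement would
  force an absolute value of at least \<open>r\<close>. So the ball meets both and, being connected,
  the frontier.\<close>

lemma signed_dist_small_imp_frontier_near:
  fixes E :: "'a::euclidean_space set"
  assumes "E \<noteq> {}" "E \<noteq> UNIV" "\<bar>signed_dist E x\<bar> < r"
  obtains p where "p \<in> frontier E" "dist x p < r"
proof -
  have r: "r > 0" using assms(3) by linarith
  have "\<not> ball x r \<subseteq> E" using signed_dist_le_if_ball_subset[OF assms(2) _ r] assms(3) by force
  moreover have "\<not> ball x r \<subseteq> - E"
    using signed_dist_ge_if_ball_disjoint[OF assms(1) _ r] assms(3) by force
  ultimately have "ball x r \<inter> frontier E \<noteq> {}"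
    by (intro connected_Int_frontier) auto
  then show ?thesis using that by auto
qed

subsection \<open>Uniform limits of signed distances\<close>

text \<open>Tangent balls at points of \<open>cball 0 R\<close> reach at most to radius R +
  2\<delta>; the radius R + 3\<delta> therefore keeps them, with a margin, where the convergence is
  uniform.\<close>

locale uniform_ball_limit =
  fixes E :: "nat \<Rightarrow> 'a::euclidean_space set" and \<delta> R :: real and s :: "'a \<Rightarrow> real"
  assumes \<delta>: "\<delta> > 0" and R: "R \<ge> 0"
    and closed_E: "closed (E n)" and ball_E: "ball_condition \<delta> (E n)"
    and E_sub: "E n \<subseteq> cball 0 R" and E_ne: "E n \<noteq> {}"
    and unif: "uniform_limit (cball 0 (R + 3 * \<delta>)) (\<lambda>n. signed_dist (E n)) s sequentially"
begin

definition S :: "'a set" where "S = cball 0 (R + 3 * \<delta>)"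
definition L :: "'a set" where "L = {x \<in> S. s x \<le> 0}"
definition Z :: "'a set" where "Z = {x \<in> S. s x = 0}"

lemma E_ne_UNIV: "E n \<noteq> UNIV"
  using E_sub[of n] not_bounded_UNIV bounded_cball bounded_subset by metis

lemma tendsto_s: "x \<in> S \<Longrightarrow> (\<lambda>n. signed_dist (E n) x) \<longlonglongrightarrow> s x"
  using tendsto_uniform_limitI[OF unif] by (simp add: S_def)

lemma continuous_on_s: "continuous_on S s"
  unfolding S_def
proof (rule uniform_limit_theorem[OF _ unif])
  have "continuous_on A (signed_dist (E n))" for n A
    unfolding signed_dist_def[abs_def] by (intro continuous_intros)
  then show "\<forall>\<^sub>F n in sequentially. continuous_on (cball 0 (R + 3 * \<delta>)) (signed_dist (E n))"
    by simp
qed simp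

text \<open>The ball of radius norm x - R about \<open>x\<close> misses every \<open>E n\<close>,
  and this margin survives the limit. Hence \<open>L\<close> stays away from the edge of
  \<open>S\<close>, and cutting off at \<open>S\<close> creates no spurious boundary.\<close>

lemma s_pos_outside: assumes "x \<in> S" "norm x > R" shows "s x > 0"
proof -
  have "ball x (norm x - R) \<subseteq> - E n" for n
  proof
    fix w assume "w \<in> ball x (norm x - R)"
    then have "norm w > R" using norm_triangle_ineq2[of x w] by (simp add: dist_norm)
    then show "w \<in> - E n" using E_sub[of n] by force
  qed
  then have "norm x - R \<le> signed_dist (E n) x" for n
    using assms(2) E_ne by (intro signed_dist_ge_if_ball_disjoint) auto
  then have "norm x - R \<le> s x"
    by (intro LIMSEQ_le_const[OF tendsto_s[OF assms(1)]]) auto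
  then show ?thesis using assms(2) by simp
qed

lemma L_sub: "L \<subseteq> cball 0 R"
  using s_pos_outside by (force simp: L_def)

lemma Z_sub: "Z \<subseteq> L" by (auto simp: Z_def L_def)

lemma closed_L: "closed L" and compact_Z: "compact Z"
proof -
  have "closed (S \<inter> s -` {..0})" "closed (S \<inter> s -` {0})"
    by (intro continuous_closed_preimage continuous_on_s; simp add: S_def)+
  moreover have "L = S \<inter> s -` {..0}" "Z = S \<inter> s -` {0}" by (auto simp: L_def Z_def)
  moreover have "bounded Z" using Z_sub L_sub bounded_cball bounded_subset by metis
  ultimately show "closed L" "compact Z" by (auto simp: compact_eq_bounded_closed)
qed

text \<open>Frontier points tend to \<open>x\<close> because the signed distances at
  \<open>x\<close> tend to 0; the centres of their tangent balls are bounded, so some subsequence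
  converges. \<open>G\<close> will be \<open>E\<close> or its complement. A neighbourhood of fixed
  size is recorded, not just membership of \<open>w\<close>, since it yields a strict sign of
  \<open>s\<close>.\<close>

lemma tangent_ball_limit:
  assumes x: "x \<in> Z" and G: "\<And>n p. p \<in> frontier (E n) \<Longrightarrow> \<exists>y. ball y \<delta> \<subseteq> G n \<and> dist p y = \<delta>"
  obtains y r where "strict_mono (r :: nat \<Rightarrow> nat)" "dist x y = \<delta>"
    "\<And>w. dist y w < \<delta> \<Longrightarrow> \<exists>\<eta>>0. \<forall>\<^sub>F k in sequentially. ball w \<eta> \<subseteq> G (r k)"
proof -
  have xS: "x \<in> S" and sx: "s x = 0" using x by (auto simp: Z_def)
  \<comment> \<open>The summand 1 / (n + 1) makes the inequality strict, so that a frontier point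
    can be picked even where the signed distance is 0.\<close>
  define d where "d n = \<bar>signed_dist (E n) x\<bar> + 1 / real (Suc n)" for n
  have "(\<lambda>n. signed_dist (E n) x) \<longlonglongrightarrow> 0" using tendsto_s[OF xS] sx by simp
  then have d0: "d \<longlonglongrightarrow> 0"
    unfolding d_def using tendsto_add[OF tendsto_rabs_zero LIMSEQ_Suc[OF lim_1_over_n]] by fastforce
  have "\<exists>p. p \<in> frontier (E n) \<and> dist x p < d n" for n
    by (rule signed_dist_small_imp_frontier_near[of "E n" x "d n"])
       (auto simp: E_ne E_ne_UNIV d_def)
  then obtain p where p: "\<And>n. p n \<in> frontier (E n)" "\<And>n. dist x (p n) < d n" by metis
  then have "\<exists>y. ball y \<delta> \<subseteq> G n \<and> dist (p n) y = \<delta>" for n using G by blast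
  then obtain y where y: "\<And>n. ball (y n) \<delta> \<subseteq> G n" "\<And>n. dist (p n) (y n) = \<delta>" by metis
  have plim: "p \<longlonglongrightarrow> x"
  proof (rule Lim_transform_bound[OF _ d0, THEN LIM_zero_cancel])
    show "\<forall>\<^sub>F n in sequentially. norm (p n - x) \<le> norm (d n)"
      using p(2) by (intro always_eventually allI) (auto simp: dist_norm norm_minus_commute d_def intro: less_imp_le)
  qed
  have "y n \<in> cball 0 (R + \<delta>)" for n
  proof -
    have "p n \<in> cball 0 R"
      using p(1)[of n] E_sub[of n] closed_E[of n] frontier_subset_closed by blast
    then show ?thesis using y(2)[of n] norm_triangle_ineq2[of "y n" "p n"]
      by (simp add: dist_norm norm_minus_commute)
  qed
  then obtain l r where r: "strict_mono (r :: nat \<Rightarrow> nat)" and l: "(y \<circ> r) \<longlonglongrightarrow> l"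
    using compact_cball[of "0::'a" "R + \<delta>"] unfolding compact_def by metis
  have "(\<lambda>k. dist (p (r k)) (y (r k))) \<longlonglongrightarrow> dist x l"
    using LIMSEQ_subseq_LIMSEQ[OF plim r] l by (intro tendsto_intros) (simp_all add: comp_def)
  then have "dist x l = \<delta>" using y(2) by (simp add: LIMSEQ_const_iff)
  moreover have "\<exists>\<eta>>0. \<forall>\<^sub>F k in sequentially. ball w \<eta> \<subseteq> G (r k)" if w: "dist l w < \<delta>" for w
  proof (intro exI conjI)
    \<comment> \<open>Half of the gap between \<open>w\<close> and the limit sphere absorbs the
      displacement of the centres; the other half is the radius about \<open>w\<close>.\<close>
    define \<eta> where "\<eta> = (\<delta> - dist l w) / 2"
    show "\<eta> > 0" using w by (simp add: \<eta>_def)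
    have "\<forall>\<^sub>F k in sequentially. dist (y (r k)) l < \<eta>"
      using tendstoD[OF l \<open>\<eta> > 0\<close>] by simp
    then show "\<forall>\<^sub>F k in sequentially. ball w \<eta> \<subseteq> G (r k)"
    proof eventually_elim
      case (elim k)
      have "dist w (y (r k)) + \<eta> \<le> \<delta>"
        using elim dist_triangle[of w "y (r k)" l] by (simp add: \<eta>_def dist_commute field_simps)
      then have "ball w \<eta> \<subseteq> ball (y (r k)) \<delta>" by (simp add: ball_subset_ball_iff)
      then show ?case using y(1) by blast
    qed
  qed
  ultimately show ?thesis using that r by blast
qed

text \<open>On the limit ball s \<le> -\<eta> < 0 with \<eta> depending on the point, so the ball
  avoids \<open>Z\<close> as well. This is the porosity of \<open>Z\<close>.\<close>

lemma Z_inner_ball: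
  assumes "x \<in> Z"
  obtains y where "dist x y = \<delta>" "ball y \<delta> \<subseteq> L - Z"
proof -
  have G: "\<exists>y. ball y \<delta> \<subseteq> E n \<and> dist p y = \<delta>" if "p \<in> frontier (E n)" for n p
    using ball_E that by (auto simp: ball_condition_def)
  obtain y r where r: "strict_mono (r :: nat \<Rightarrow> nat)" and y: "dist x y = \<delta>"
    and b: "\<And>w. dist y w < \<delta> \<Longrightarrow> \<exists>\<eta>>0. \<forall>\<^sub>F k in sequentially. ball w \<eta> \<subseteq> E (r k)"
    by (rule tangent_ball_limit[OF assms G]) (assumption | rule that)+
  have "w \<in> L - Z" if w: "w \<in> ball y \<delta>" for w
  proof -
    obtain \<eta> where \<eta>: "\<eta> > 0" "\<forall>\<^sub>F k in sequentially. ball w \<eta> \<subseteq> E (r k)"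
      using b w by auto
    have "norm x \<le> R" using assms Z_sub L_sub by auto
    then have wS: "w \<in> S"
      using w y norm_triangle_ineq2[of w y] norm_triangle_ineq2[of y x] \<delta>
      by (simp add: S_def dist_norm norm_minus_commute)
    have "\<forall>\<^sub>F k in sequentially. signed_dist (E (r k)) w \<le> - \<eta>"
      using \<eta>(2) by eventually_elim (rule signed_dist_le_if_ball_subset[OF E_ne_UNIV _ \<eta>(1)])
    moreover have "(\<lambda>k. signed_dist (E (r k)) w) \<longlonglongrightarrow> s w"
      using LIMSEQ_subseq_LIMSEQ[OF tendsto_s[OF wS] r] by (simp add: comp_def)
    ultimately have "s w \<le> - \<eta>" by (intro tendsto_upperbound) auto
    then show ?thesis using \<eta>(1) wS by (simp add: L_def Z_def)
  qed
  then show ?thesis using that y by blast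
qed

lemma Z_outer_ball:
  assumes "x \<in> Z"
  obtains z where "dist x z = \<delta>" "ball z \<delta> \<subseteq> - L"
proof -
  have G: "\<exists>y. ball y \<delta> \<subseteq> - E n \<and> dist p y = \<delta>" if "p \<in> frontier (E n)" for n p
    using ball_E that by (auto simp: ball_condition_def)
  obtain y r where r: "strict_mono (r :: nat \<Rightarrow> nat)" and y: "dist x y = \<delta>"
    and b: "\<And>w. dist y w < \<delta> \<Longrightarrow> \<exists>\<eta>>0. \<forall>\<^sub>F k in sequentially. ball w \<eta> \<subseteq> - E (r k)"
    by (rule tangent_ball_limit[OF assms G]) (assumption | rule that)+
  have "w \<notin> L" if w: "w \<in> ball y \<delta>" for w
  proof (cases "w \<in> S")
    case wS: True
    obtain \<eta> where \<eta>: "\<eta> > 0" "\<forall>\<^sub>F k in sequentially. ball w \<eta> \<subseteq> - E (r k)"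
      using b w by auto
    have "\<forall>\<^sub>F k in sequentially. signed_dist (E (r k)) w \<ge> \<eta>"
      using \<eta>(2) by eventually_elim (rule signed_dist_ge_if_ball_disjoint[OF E_ne _ \<eta>(1)])
    moreover have "(\<lambda>k. signed_dist (E (r k)) w) \<longlonglongrightarrow> s w"
      using LIMSEQ_subseq_LIMSEQ[OF tendsto_s[OF wS] r] by (simp add: comp_def)
    ultimately have "s w \<ge> \<eta>" by (intro tendsto_lowerbound) auto
    then show ?thesis using \<eta>(1) by (simp add: L_def)
  qed (simp add: L_def)
  then show ?thesis using that y by blast
qed

text \<open>Continuity of \<open>s\<close> shows that frontier points are zeros. Conversely, a zero
  might lie in the interior of \<open>L\<close>; the outer tangent ball, whose closure contains it,
  excludes this.\<close>

lemma frontier_L: "frontier L = Z"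
proof
  show "frontier L \<subseteq> Z"
  proof
    fix x assume x: "x \<in> frontier L"
    then have "x \<in> L" using closed_L frontier_subset_closed by blast
    have "\<not> s x < 0"
    proof
      assume neg: "s x < 0"
      define U where "U = ball 0 (R + 3 * \<delta>) \<inter> s -` {..<0}"
      have "continuous_on (ball 0 (R + 3 * \<delta>)) s"
        using continuous_on_subset[OF continuous_on_s] by (auto simp: S_def)
      then have "open U" unfolding U_def by (intro continuous_open_preimage) auto
      moreover have "U \<subseteq> L" by (auto simp: U_def L_def S_def)
      moreover have "x \<in> U" using neg \<open>x \<in> L\<close> L_sub \<delta> by (force simp: U_def)
      ultimately have "x \<in> interior L" by (meson interior_maximal subsetD)
      then show False using x by (simp add: frontier_def)
    qed
    then show "x \<in> Z" using \<open>x \<in> L\<close> by (simp add: L_def Z_def)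
  qed
  show "Z \<subseteq> frontier L"
  proof
    fix x assume x: "x \<in> Z"
    obtain z where z: "dist x z = \<delta>" "ball z \<delta> \<subseteq> - L" by (rule Z_outer_ball[OF x])
    have "x \<in> closure (ball z \<delta>)" using z(1) \<delta> by (simp add: dist_commute)
    then have "x \<in> closure (- L)" using closure_mono[OF z(2)] by blast
    moreover have "x \<in> closure L" using x Z_sub closure_subset by blast
    ultimately show "x \<in> frontier L" by (simp add: frontier_closures)
  qed
qed

lemma L_in_K_class: "L \<in> K_class \<delta>"
proof -
  have "(\<exists>y. ball y \<delta> \<subseteq> L \<and> dist x y = \<delta>) \<and> (\<exists>z. ball z \<delta> \<subseteq> - L \<and> dist x z = \<delta>)" if x: "x \<in> Z" for x
    using Z_inner_ball[OF x] Z_outer_ball[OF x] by (metis Diff_subset order_trans)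
  then show ?thesis
    using closed_L by (simp add: K_class_def ball_condition_def frontier_L)
qed

lemma negligible_Z: "negligible Z"
proof (rule negligible_if_external_tangent_balls[OF compact_Z \<delta>])
  fix x assume "x \<in> Z"
  then obtain y where "dist x y = \<delta>" "ball y \<delta> \<subseteq> L - Z" by (rule Z_inner_ball)
  then show "\<exists>y. dist x y = \<delta> \<and> ball y \<delta> \<inter> Z = {}" by blast
qed

text \<open>Off the null set \<open>Z\<close> the signed distances in \<open>S\<close> have a
  nonzero limit, so membership in \<open>E n\<close> is eventually constant.\<close>

lemma AE_tendsto_indicator: "AE x in lebesgue. (\<lambda>n. indicator (E n) x :: real) \<longlonglongrightarrow> indicator L x"
proof (rule AE_I')
  show "Z \<in> null_sets lebesgue" using negligible_Z by (simp add: negligible_iff_null_sets)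
  have "(\<lambda>n. indicator (E n) x :: real) \<longlonglongrightarrow> indicator L x" if "x \<notin> Z" for x
  proof (rule tendsto_eventually)
    consider "x \<notin> S" | "x \<in> S" "s x < 0" | "x \<in> S" "s x > 0"
      using \<open>x \<notin> Z\<close> by (force simp: Z_def)
    then show "\<forall>\<^sub>F n in sequentially. indicator (E n) x = (indicator L x :: real)"
    proof cases
      case 1
      then have "x \<notin> L" "\<And>n. x \<notin> E n" using E_sub \<delta> by (force simp: L_def S_def)+
      then show ?thesis by simp
    next
      case 2
      then have "\<forall>\<^sub>F n in sequentially. signed_dist (E n) x < 0"
        using order_tendstoD(2)[OF tendsto_s] by blast
      then show ?thesis
        by eventually_elim (use 2 signed_dist_neg_imp_mem in \<open>auto simp: L_def indicator_def\<close>)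
    next
      case 3
      then have "\<forall>\<^sub>F n in sequentially. signed_dist (E n) x > 0"
        using order_tendstoD(1)[OF tendsto_s] by blast
      then show ?thesis
      proof eventually_elim
        case (elim n)
        then have "x \<notin> E n" using signed_dist_le_0[of x "E n"] by force
        then show ?case using 3 by (simp add: L_def)
      qed
    qed
  qed
  then show "{x \<in> space lebesgue. \<not> (\<lambda>n. indicator (E n) x :: real) \<longlonglongrightarrow> indicator L x} \<subseteq> Z"
    by blast
qed

lemma lebesgue_sets: "E n \<in> sets lebesgue" "L \<in> sets lebesgue"
proof -
  have "A \<in> sets lebesgue" if "closed A" for A :: "'a set"
    using borel_closed[OF that] by simp
  then show "E n \<in> sets lebesgue" "L \<in> sets lebesgue" using closed_E closed_L by simp_all
qed

lemma emeasure_L: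
  assumes "\<And>n. emeasure lebesgue (E n) = ennreal m" "m \<ge> 0"
  shows "emeasure lebesgue L = ennreal m"
proof -
  have fin: "emeasure lebesgue L \<noteq> top"
    using emeasure_mono[OF L_sub, of lebesgue] emeasure_bounded_finite[of "cball (0::'a) R"] by (auto simp: top_unique)
  have "(\<lambda>n. LINT x:E n|lebesgue. (1::real)) \<longlonglongrightarrow> (LINT x:L|lebesgue. 1)"
    by (rule tendsto_set_integral[OF _ lebesgue_sets(1) E_sub lebesgue_sets(2) AE_tendsto_indicator])
       (rule continuous_on_const)
  then have "(\<lambda>n. measure lebesgue (E n)) \<longlonglongrightarrow> measure lebesgue L"
    using lebesgue_sets by (simp add: set_lebesgue_integral_def)
  moreover have "measure lebesgue (E n) = m" for n
    using assms by (simp add: measure_def)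
  ultimately have "measure lebesgue L = m" by (simp add: LIMSEQ_const_iff)
  then show ?thesis using fin by (simp add: emeasure_eq_ennreal_measure)
qed

text \<open>By the Lipschitz bound the signed distance at \<open>x\<close> is close to its value at
  \<open>X n\<close>, which is non-positive, and 0 on the frontier.\<close>

lemma cluster_point:
  assumes r: "strict_mono (r :: nat \<Rightarrow> nat)" and X: "\<And>n. X n \<in> E (r n)" "X \<longlonglongrightarrow> x"
  shows cluster_point_mem: "x \<in> L"
    and cluster_point_frontier: "(\<And>n. X n \<in> frontier (E (r n))) \<Longrightarrow> x \<in> frontier L"
proof -
  have "x \<in> cball 0 R"
    by (rule closed_sequentially[OF closed_cball _ X(2)]) (use X(1) E_sub in blast)
  then have xS: "x \<in> S" using \<delta> by (simp add: S_def)
  have lim: "(\<lambda>n. signed_dist (E (r n)) x) \<longlonglongrightarrow> s x"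
    using LIMSEQ_subseq_LIMSEQ[OF tendsto_s[OF xS] r] by (simp add: comp_def)
  have d: "(\<lambda>n. 2 * dist x (X n)) \<longlonglongrightarrow> 0"
  proof -
    have "(\<lambda>n. 2 * dist x (X n)) \<longlonglongrightarrow> 2 * dist x x"
      by (intro tendsto_intros X(2))
    then show ?thesis by simp
  qed
  have "signed_dist (E (r n)) x \<le> 2 * dist x (X n)" for n
    using signed_dist_lipschitz[of "E (r n)" x "X n"] signed_dist_le_0[OF X(1)[of n]] by linarith
  then have "s x \<le> 0" by (intro LIMSEQ_le[OF lim d]) auto
  then show "x \<in> L" using xS by (simp add: L_def)
  assume fr: "\<And>n. X n \<in> frontier (E (r n))"
  have "\<bar>signed_dist (E (r n)) x\<bar> \<le> 2 * dist x (X n)" for n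
    using signed_dist_lipschitz[of "E (r n)" x "X n"] signed_dist_frontier[OF fr[of n]] by linarith
  then have "\<bar>s x\<bar> \<le> 0" by (intro LIMSEQ_le[OF tendsto_rabs[OF lim] d]) auto
  then show "x \<in> frontier L" using xS by (simp add: frontier_L Z_def)
qed

text \<open>A splitting of \<open>L\<close> would pass to \<open>E n\<close>: disjoint open
  neighbourhoods of the two pieces both meet \<open>E n\<close> by pointwise convergence, and they
  cover it by uniform convergence, as \<open>s\<close> has a positive minimum on the compact rest of
  \<open>S\<close> unless that rest is empty.\<close>

lemma connected_L:
  assumes conn: "\<And>n. connected (E n)"
  shows "connected L"
proof (rule ccontr)
  assume "\<not> connected L"
  then obtain A B where AB: "closed A" "closed B" "A \<noteq> {}" "B \<noteq> {}" "A \<union> B = L" "A \<inter> B = {}"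
    unfolding connected_closed_set[OF closed_L] by blast
  obtain U V where UV: "open U" "open V" "A \<subseteq> U" "B \<subseteq> V" "U \<inter> V = {}"
    using separation_normal[OF AB(1,2,6)] by metis
  have meets: "\<forall>\<^sub>F n in sequentially. W \<inter> E n \<noteq> {}" if W: "open W" "a \<in> W" "a \<in> L" for W a
  proof -
    obtain e where e: "e > 0" "ball a e \<subseteq> W" using W open_contains_ball by blast
    have "a \<in> S" "s a < e" using W(3) e by (auto simp: L_def)
    then have "\<forall>\<^sub>F n in sequentially. signed_dist (E n) a < e"
      using order_tendstoD(2)[OF tendsto_s] by blast
    then show ?thesis
    proof eventually_elim
      case (elim n)
      then have "\<not> ball a e \<subseteq> - E n"
        using signed_dist_ge_if_ball_disjoint[OF E_ne[of n] _ e(1), of a] by force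
      then show ?case using e(2) by blast
    qed
  qed
  have mU: "\<forall>\<^sub>F n in sequentially. U \<inter> E n \<noteq> {}" and mV: "\<forall>\<^sub>F n in sequentially. V \<inter> E n \<noteq> {}"
    using meets[OF UV(1)] meets[OF UV(2)] AB UV by blast+
  have cover: "\<forall>\<^sub>F n in sequentially. E n \<subseteq> U \<union> V"
  proof (cases "S - (U \<union> V) = {}")
    case True
    have "E n \<subseteq> S" for n using E_sub[of n] \<delta> by (force simp: S_def)
    then show ?thesis using True by (intro always_eventually) blast
  next
    case False
    have "compact (S - (U \<union> V))" using UV by (intro compact_diff) (auto simp: S_def)
    moreover have "continuous_on (S - (U \<union> V)) s"
      using continuous_on_s continuous_on_subset by blast
    ultimately obtain x where x: "x \<in> S - (U \<union> V)" "\<And>w. w \<in> S - (U \<union> V) \<Longrightarrow> s x \<le> s w"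
      using continuous_attains_inf[OF _ False] by blast
    have "x \<notin> L" using x(1) AB UV by blast
    then have "s x > 0" using x(1) by (auto simp: L_def)
    then have "\<forall>\<^sub>F n in sequentially. \<forall>w\<in>S. dist (signed_dist (E n) w) (s w) < s x"
      using uniform_limitD[OF unif] by (simp add: S_def)
    then show ?thesis
    proof eventually_elim
      case (elim n)
      show ?case
      proof
        fix w assume w: "w \<in> E n"
        then have wS: "w \<in> S" using E_sub[of n] \<delta> by (force simp: S_def)
        show "w \<in> U \<union> V"
        proof (rule ccontr)
          assume "w \<notin> U \<union> V"
          then have "s x \<le> s w" using x(2) wS by blast
          then show False using elim wS signed_dist_le_0[OF w] by (force simp: dist_real_def)
        qed
      qed
    qed
  qed
  have "\<forall>\<^sub>F n in sequentially. False"
    using mU mV cover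
  proof eventually_elim
    case (elim n)
    then show False using connectedD[OF conn[of n] UV(1,2)] UV(5) by blast
  qed
  then show False by simp
qed

end

subsection \<open>Existence of minimizers\<close>

lemma uniform_limit_subseq:
  assumes "uniform_limit A f l sequentially" "strict_mono (r :: nat \<Rightarrow> nat)"
  shows "uniform_limit A (\<lambda>n. f (r n)) l sequentially"
proof (rule uniform_limitI)
  fix e :: real assume "e > 0"
  from eventually_subseq[OF assms(2) uniform_limitD[OF assms(1) this]]
  show "\<forall>\<^sub>F n in sequentially. \<forall>x\<in>A. dist (f (r n) x) (l x) < e" .
qed

lemma uniform_ball_limit_subseq:
  assumes "uniform_ball_limit E \<delta> R s" "strict_mono r"
  shows "uniform_ball_limit (\<lambda>n. E (r n)) \<delta> R s"
  using assms uniform_limit_subseq[OF _ assms(2), where f = "\<lambda>n. signed_dist (E n)"]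
  unfolding uniform_ball_limit_def by simp

lemma emeasure_lebesgue_translation:
  fixes E :: "'a::euclidean_space set"
  shows "emeasure lebesgue ((+) a ` E) = emeasure lebesgue E"
  using emeasure_lebesgue_affine[of 1 a E] by (simp add: add.commute[of _ a])

lemma K_class_co_compactness:
  fixes E :: "nat \<Rightarrow> 'a::euclidean_space set"
  assumes \<delta>: "\<delta> > 0" and m: "m > 0"
    and vol: "\<And>n. emeasure lebesgue (E n) = ennreal m" and E: "\<And>n. E n \<in> K_class_co \<delta>"
  obtains r a R s where "strict_mono (r :: nat \<Rightarrow> nat)"
    "uniform_ball_limit (\<lambda>n. (+) (a n) ` E (r n)) \<delta> R s"
proof -
  have "\<exists>x. x \<in> E n" for n using vol[of n] m by (metis all_not_in_conv emeasure_empty ennreal_eq_0_iff not_less)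
  then obtain x where x: "\<And>n. x n \<in> E n" by metis
  define F where "F n = (+) (- x n) ` E n" for n
  have FK: "F n \<in> K_class_co \<delta>" for n
    unfolding F_def by (rule K_class_co_translation[OF E])
  have F0: "0 \<in> F n" for n using x[of n] by (force simp: F_def)
  have closed_F: "closed (F n)" and ball_F: "ball_condition \<delta> (F n)" and conn_F: "connected (F n)" for n
    using FK[of n] by (auto simp: K_class_co_def K_class_def)
  obtain K where K: "real K * measure lebesgue (ball (0::'a) \<delta>) > m"
    using reals_Archimedean3[of "measure lebesgue (ball (0::'a) \<delta>)"] \<delta> by auto
  define R where "R = 6 * \<delta> * real K"
  have R: "R \<ge> 0" using \<delta> by (simp add: R_def)
  have F_sub: "F n \<subseteq> cball 0 R" for n
    unfolding R_def
  proof (rule ball_condition_connected_bounded[OF ball_F conn_F \<delta> _ _ F0 _ K])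
    show "F n \<in> sets lebesgue" using borel_closed[OF closed_F[of n]] by simp
    show "emeasure lebesgue (F n) \<le> ennreal m"
      unfolding F_def by (simp only: emeasure_lebesgue_translation vol)
  qed (use m in simp)
  have F_ne: "F n \<noteq> {}" for n using F0 by blast
  have F_UNIV: "F n \<noteq> UNIV" for n
    using F_sub[of n] not_bounded_UNIV bounded_cball bounded_subset by metis
  \<comment> \<open>The signed distance vanishes at a frontier point in \<open>cball 0 R\<close>,
    which is at most 2R + 3\<delta> away; the outer factor 2 is the Lipschitz constant.\<close>
  have bound: "norm (signed_dist (F n) w) \<le> 2 * (2 * R + 3 * \<delta>)" if w: "w \<in> cball 0 (R + 3 * \<delta>)" for n w
  proof -
    obtain p where p: "p \<in> frontier (F n)"
      using F0[of n] F_UNIV[of n] frontier_eq_empty[of "F n"] by blast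
    then have "p \<in> cball 0 R"
      using F_sub[of n] closed_F[of n] frontier_subset_closed by blast
    then have "dist w p \<le> 2 * R + 3 * \<delta>"
      using w norm_triangle_ineq4[of w p] by (simp add: dist_norm)
    then show ?thesis
      using signed_dist_lipschitz[of "F n" w p] signed_dist_frontier[OF p] by simp
  qed
  obtain s r where r: "strict_mono (r :: nat \<Rightarrow> nat)"
    and conv: "\<And>e. 0 < e \<Longrightarrow> \<exists>N. \<forall>n x. n \<ge> N \<and> x \<in> cball 0 (R + 3 * \<delta>) \<longrightarrow> norm (signed_dist (F (r n)) x - s x) < e"
  proof (rule Arzela_Ascoli[of "cball (0::'a) (R + 3 * \<delta>)" "\<lambda>n. signed_dist (F n)" "2 * (2 * R + 3 * \<delta>)"])
    fix w :: 'a and e :: real assume "0 < e"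
    then show "\<exists>d>0. \<forall>n y. y \<in> cball 0 (R + 3 * \<delta>) \<and> norm (w - y) < d \<longrightarrow>
        norm (signed_dist (F n) w - signed_dist (F n) y) < e"
    proof (intro exI[of _ "e / 2"] conjI allI impI)
      fix n y assume "y \<in> cball 0 (R + 3 * \<delta>) \<and> norm (w - y) < e / 2"
      then show "norm (signed_dist (F n) w - signed_dist (F n) y) < e"
        using signed_dist_lipschitz[of "F n" w y] by (simp add: dist_norm)
    qed simp
  qed (use bound in auto)
  have "uniform_limit (cball 0 (R + 3 * \<delta>)) (\<lambda>n. signed_dist (F (r n))) s sequentially"
    unfolding uniform_limit_sequentially_iff dist_norm using conv by blast
  then have "uniform_ball_limit (\<lambda>n. F (r n)) \<delta> R s"
    using \<delta> R closed_F ball_F F_sub F_ne by unfold_locales auto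
  then show ?thesis using that[OF r, of "\<lambda>n. - x (r n)" R s] by (simp add: F_def)
qed

section \<open>The ball as a competitor, and the direct method\<close>

lemma cball_in_K_class_co:
  assumes "0 < \<delta>" "\<delta> \<le> \<rho>"
  shows "cball (0::'a::euclidean_space) \<rho> \<in> K_class_co \<delta>"
proof -
  have "(\<exists>y. ball y \<delta> \<subseteq> cball 0 \<rho> \<and> dist x y = \<delta>) \<and> (\<exists>z. ball z \<delta> \<subseteq> - cball 0 \<rho> \<and> dist x z = \<delta>)"
    if x: "norm x = \<rho>" for x :: 'a
  proof (intro conjI exI)
    \<comment> \<open>The centres lie on the ray from the origin through \<open>x\<close>, at
      distances \<rho> - \<delta> and \<rho> + \<delta> from the origin.\<close>
    define y where "y = (1 - \<delta> / \<rho>) *\<^sub>R x"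
    define z where "z = (1 + \<delta> / \<rho>) *\<^sub>R x"
    have ny: "norm y = \<rho> - \<delta>" and nz: "norm z = \<rho> + \<delta>"
      using x assms by (auto simp: y_def z_def abs_of_nonneg field_simps)
    have "x - y = (\<delta> / \<rho>) *\<^sub>R x" "x - z = - ((\<delta> / \<rho>) *\<^sub>R x)"
      by (simp_all add: y_def z_def algebra_simps)
    then show "dist x y = \<delta>" "dist x z = \<delta>"
      using x assms by (simp_all add: dist_norm)
    show "ball y \<delta> \<subseteq> cball 0 \<rho>"
      using ny by (simp add: ball_subset_cball_iff)
    show "ball z \<delta> \<subseteq> - cball 0 \<rho>"
    proof
      fix w assume "w \<in> ball z \<delta>"
      then show "w \<in> - cball 0 \<rho>" using nz norm_triangle_ineq2[of z w] by (simp add: dist_norm)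
    qed
  qed
  then show ?thesis
    by (auto simp: K_class_co_def K_class_def ball_condition_def)
qed

text \<open>The lower bound on \<open>m\<close> makes the radius at least \<delta>, so that the ball
  is admissible and the minimization is over a non-empty class.\<close>

lemma cball_of_volume:
  assumes \<delta>: "\<delta> > 0" and m: "m \<ge> measure lebesgue (ball (0::'a::euclidean_space) 1) * \<delta> ^ DIM('a)"
  obtains \<rho> where "\<rho> \<ge> \<delta>" "emeasure lebesgue (cball (0::'a) \<rho>) = ennreal m"
proof -
  define \<omega> where "\<omega> = unit_ball_vol (real DIM('a))"
  have \<omega>: "\<omega> > 0" by (simp add: \<omega>_def)
  have le: "\<delta> ^ DIM('a) \<le> m / \<omega>"
    using m \<omega> by (simp add: content_ball \<omega>_def field_simps)
  then have nn: "m / \<omega> \<ge> 0" using \<delta> by (meson order_trans zero_le_power less_imp_le)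
  define \<rho> where "\<rho> = root DIM('a) (m / \<omega>)"
  have "\<delta> = root DIM('a) (\<delta> ^ DIM('a))" using \<delta> by (simp add: real_root_power_cancel)
  also have "\<dots> \<le> \<rho>" unfolding \<rho>_def using le by (intro real_root_le_mono) auto
  finally have "\<delta> \<le> \<rho>" .
  moreover have "\<rho> ^ DIM('a) = m / \<omega>" unfolding \<rho>_def using nn by (intro real_root_pow_pos2) auto
  then have "emeasure lebesgue (cball (0::'a) \<rho>) = ennreal m"
    using \<omega> \<open>\<delta> \<le> \<rho>\<close> \<delta> by (simp add: emeasure_cball flip: \<omega>_def)
  ultimately show ?thesis using that by blast
qed

text \<open>\<open>T\<close> abstracts the set that carries the charge, \<open>E\<close> itself or
  its frontier, so that both problems are solved at once. \<open>T_lim\<close> is the closedness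
  under limits of points that the Riesz term requires.\<close>

lemma energy_minimizer_exists:
  fixes T :: "'a::euclidean_space set \<Rightarrow> 'a set"
  assumes \<alpha>: "\<alpha> > 0" and \<delta>: "\<delta> > 0"
    and m: "m \<ge> measure lebesgue (ball (0::'a) 1) * \<delta> ^ DIM('a)"
    and T_closed: "\<And>A. closed A \<Longrightarrow> closed (T A)" and T_sub: "\<And>A. closed A \<Longrightarrow> T A \<subseteq> A"
    and T_trans: "\<And>a A. T ((+) a ` A) = (+) a ` T A"
    and T_lim: "\<And>E R s r X x. uniform_ball_limit E \<delta> R s \<Longrightarrow> strict_mono (r :: nat \<Rightarrow> nat) \<Longrightarrow>
      (\<And>n. X n \<in> T (E (r n))) \<Longrightarrow> X \<longlonglongrightarrow> x \<Longrightarrow> x \<in> T (uniform_ball_limit.L \<delta> R s)"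
  shows "\<exists>E. is_arg_min (\<lambda>E. perimeter E + ennreal (Q\<^sup>2) * I_energy \<alpha> (T E))
    (\<lambda>E. emeasure lebesgue E = ennreal m \<and> E \<in> K_class_co \<delta>) E"
proof -
  define J where "J E = perimeter E + ennreal (Q\<^sup>2) * I_energy \<alpha> (T E)" for E
  define \<A> where "\<A> = {E :: 'a set. emeasure lebesgue E = ennreal m \<and> E \<in> K_class_co \<delta>}"
  have "measure lebesgue (ball (0::'a) 1) * \<delta> ^ DIM('a) > 0" using \<delta> by simp
  then have m0: "m > 0" using m by linarith
  obtain \<rho> where "\<rho> \<ge> \<delta>" "emeasure lebesgue (cball (0::'a) \<rho>) = ennreal m"
    by (rule cball_of_volume[OF \<delta> m])
  then have "cball 0 \<rho> \<in> \<A>" using cball_in_K_class_co[OF \<delta>] by (simp add: \<A>_def)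
  then obtain u where u: "\<And>n. u n \<in> J ` \<A>" "u \<longlonglongrightarrow> Inf (J ` \<A>)"
    using Inf_as_limit[of "J ` \<A>"] by auto
  have "\<exists>E. E \<in> \<A> \<and> J E = u n" for n using u(1)[of n] by auto
  then obtain E where E: "\<And>n. E n \<in> \<A>" "\<And>n. J (E n) = u n" by metis
  have E_vol: "emeasure lebesgue (E n) = ennreal m" and E_K: "E n \<in> K_class_co \<delta>" for n
    using E(1)[of n] by (auto simp: \<A>_def)
  obtain r a R s where r: "strict_mono (r :: nat \<Rightarrow> nat)"
    and lim0: "uniform_ball_limit (\<lambda>n. (+) (a n) ` E (r n)) \<delta> R s"
    by (rule K_class_co_compactness[OF \<delta> m0 E_vol E_K])
  define F where "F n = (+) (a n) ` E (r n)" for n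
  have closed_En: "closed (E n)" for n using E_K[of n] by (simp add: K_class_co_def K_class_def)
  have JF: "J (F n) = u (r n)" for n
    unfolding J_def F_def T_trans
    using E(2)[of "r n"]
    by (simp add: perimeter_translation I_energy_translation J_def closed_En T_closed)
  \<comment> \<open>[0, \<infinity>] is compact, so perimeters and Riesz energies converge along
    further subsequences even when infinite.\<close>
  obtain p r1 where r1: "strict_mono (r1 :: nat \<Rightarrow> nat)" and p: "(\<lambda>n. perimeter (F (r1 n))) \<longlonglongrightarrow> p"
    using compact_complete_linorder[of "\<lambda>n. perimeter (F n)"] by (auto simp: comp_def)
  obtain i r2 where r2: "strict_mono (r2 :: nat \<Rightarrow> nat)"
    and i: "(\<lambda>n. I_energy \<alpha> (T (F (r1 (r2 n))))) \<longlonglongrightarrow> i"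
    using compact_complete_linorder[of "\<lambda>n. I_energy \<alpha> (T (F (r1 n)))"] by (auto simp: comp_def)
  define q where "q n = r1 (r2 n)" for n
  have q: "strict_mono q" using r1 r2 by (simp add: q_def strict_mono_def)
  interpret uniform_ball_limit "\<lambda>n. F (q n)" \<delta> R s
    by (rule uniform_ball_limit_subseq[OF lim0[folded F_def] q])
  have closed_F: "closed (F n)" for n
    unfolding F_def by (intro closed_translation closed_En)
  have F_vol: "emeasure lebesgue (F n) = ennreal m" for n
    unfolding F_def by (simp only: emeasure_lebesgue_translation E_vol)
  have F_conn: "connected (F n)" for n
    using K_class_co_translation[OF E_K, of "a n" "r n"] by (simp add: F_def K_class_co_def)
  have pq: "(\<lambda>n. perimeter (F (q n))) \<longlonglongrightarrow> p"
    using LIMSEQ_subseq_LIMSEQ[OF p r2] by (simp add: comp_def q_def)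
  have iq: "(\<lambda>n. I_energy \<alpha> (T (F (q n)))) \<longlonglongrightarrow> i"
    using i by (simp add: q_def)
  have "L \<in> \<A>"
    using emeasure_L[OF F_vol less_imp_le[OF m0]] L_in_K_class connected_L[OF F_conn]
    by (simp add: \<A>_def K_class_co_def)
  have "perimeter L \<le> p"
    by (rule perimeter_lower_semicontinuous[OF lebesgue_sets(1) E_sub lebesgue_sets(2) AE_tendsto_indicator pq])
  moreover have "I_energy \<alpha> (T L) \<le> i"
  proof (rule I_energy_lower_semicontinuous[OF \<alpha> R _ _ _ _ iq])
    show "T (F (q n)) \<in> sets borel" for n using T_closed[OF closed_F] by (rule borel_closed)
    show "T L \<in> sets borel" using T_closed[OF closed_L] by (rule borel_closed)
    show "T (F (q n)) \<subseteq> cball 0 R" for n using T_sub[OF closed_F] E_sub by blast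
    show "x \<in> T L" if "strict_mono k" "\<And>n. X n \<in> T (F (q (k n)))" "X \<longlonglongrightarrow> x"
      for k :: "nat \<Rightarrow> nat" and X x
      by (rule T_lim[OF uniform_ball_limit_axioms that])
  qed
  ultimately have "J L \<le> p + ennreal (Q\<^sup>2) * i"
    unfolding J_def by (intro add_mono mult_left_mono) auto
  also have "p + ennreal (Q\<^sup>2) * i = Inf (J ` \<A>)"
  proof (rule LIMSEQ_unique)
    \<comment> \<open>Multiplication by the finite constant Q^2 is continuous on [0, \<infinity>],
      also for Q = 0, where 0 * \<infinity> = 0.\<close>
    show "(\<lambda>n. J (F (q n))) \<longlonglongrightarrow> p + ennreal (Q\<^sup>2) * i"
      unfolding J_def by (intro tendsto_add pq ennreal_tendsto_cmult iq) simp
    show "(\<lambda>n. J (F (q n))) \<longlonglongrightarrow> Inf (J ` \<A>)"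
      using LIMSEQ_subseq_LIMSEQ[OF u(2) strict_mono_compose[OF r q]] by (simp add: JF comp_def)
  qed
  finally have "J L \<le> J A" if "A \<in> \<A>" for A
    using that by (meson INF_lower order_trans)
  then have "is_arg_min J (\<lambda>E. E \<in> \<A>) L"
    using \<open>L \<in> \<A>\<close> by (simp add: is_arg_min_def not_less)
  then show ?thesis
    unfolding J_def[abs_def] \<A>_def by auto
qed

theorem theorem4p2:
  fixes \<alpha> \<delta> m Q :: real
  assumes "CARD('d::finite) \<ge> 2"
    and "0 < \<alpha>" and "\<alpha> < real CARD('d)"
    and "\<delta> > 0"
    and "m \<ge> measure lebesgue (ball (0 :: real ^ 'd) 1) * \<delta> ^ CARD('d)"
    and "Q \<ge> 0"
  shows "(\<exists>E :: (real ^ 'd) set.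
            is_arg_min (F_energy \<alpha> Q) (\<lambda>E. emeasure lebesgue E = ennreal m \<and> E \<in> K_class_co \<delta>) E) \<and>
         (\<exists>E :: (real ^ 'd) set.
            is_arg_min (G_energy \<alpha> Q) (\<lambda>E. emeasure lebesgue E = ennreal m \<and> E \<in> K_class_co \<delta>) E)"
proof -
  have m: "m \<ge> measure lebesgue (ball (0 :: real ^ 'd) 1) * \<delta> ^ DIM(real ^ 'd)"
    using assms(5) by simp
  show ?thesis
    unfolding F_energy_def[abs_def] G_energy_def[abs_def]
  proof
    show "\<exists>E :: (real ^ 'd) set. is_arg_min (\<lambda>E. perimeter E + ennreal (Q\<^sup>2) * I_energy \<alpha> E)
        (\<lambda>E. emeasure lebesgue E = ennreal m \<and> E \<in> K_class_co \<delta>) E"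
      by (rule energy_minimizer_exists[OF assms(2,4) m, where T = "\<lambda>E. E"])
         (auto intro: uniform_ball_limit.cluster_point_mem)
    show "\<exists>E :: (real ^ 'd) set. is_arg_min (\<lambda>E. perimeter E + ennreal (Q\<^sup>2) * I_energy \<alpha> (frontier E))
        (\<lambda>E. emeasure lebesgue E = ennreal m \<and> E \<in> K_class_co \<delta>) E"
    proof (rule energy_minimizer_exists[OF assms(2,4) m, where T = frontier])
      fix E :: "nat \<Rightarrow> (real ^ 'd) set" and R s X x and r :: "nat \<Rightarrow> nat"
      assume "uniform_ball_limit E \<delta> R s"
      then interpret uniform_ball_limit E \<delta> R s .
      assume "strict_mono r" and X: "\<And>n. X n \<in> frontier (E (r n))" and "X \<longlonglongrightarrow> x"
      moreover have "X n \<in> E (r n)" for n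
        using X closed_E frontier_subset_closed by blast
      ultimately show "x \<in> frontier L"
        by (intro cluster_point_frontier)
    qed (auto simp: frontier_translation frontier_subset_closed)
  qed
qed

end
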